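(* There is no invariant bond percolation process on the square lattice $\mathbb{Z}^2$ which has more than two robust clusters (with positive probability).
   Context: $\mathbb{Z}^2$ denotes the square lattice graph, whose vertices are the integer points of the plane and whose edges join points at Euclidean distance $1$. An invariant bond percolation process on a graph $G$ is a random subset of the edge set of $G$ whose distribution is invariant under all graph automorphisms of $G$. The clusters of the process are the connected components of the random subgraph formed by the retained edges. A cluster $C$ is called robust if its critical percolation probability is strictly less than $1$, i.e. there is $\epsilon>0$ such that if each edge of $C$ is deleted independently with probability $\epsilon$, then with positive probability the remaining subgraph of $C$ still has an infinite connected component. *)

theory Defs
  imports "HOL-Probability.Probability"
begin

type_synonym vtx = "int \<times> int"
type_synonym edge = "vtx set"

definition z2_adj :: "vtx \<Rightarrow> vtx \<Rightarrow> bool" where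
  "z2_adj u v \<longleftrightarrow> \<bar>fst u - fst v\<bar> + \<bar>snd u - snd v\<bar> = 1"

definition Z2E :: "edge set" where
  "Z2E = {{u, v} | u v. z2_adj u v}"

definition z2_aut :: "(vtx \<Rightarrow> vtx) \<Rightarrow> bool" where
  "z2_aut \<phi> \<longleftrightarrow> bij \<phi> \<and> (\<forall>u v. z2_adj (\<phi> u) (\<phi> v) \<longleftrightarrow> z2_adj u v)"

definition z2_cfg :: "edge set measure" where
  "z2_cfg = sigma (Pow Z2E) {{\<omega> \<in> Pow Z2E. e \<in> \<omega>} | e. e \<in> Z2E}"

definition act :: "(vtx \<Rightarrow> vtx) \<Rightarrow> edge set \<Rightarrow> edge set" where
  "act \<phi> \<omega> = (\<lambda>e. \<phi> ` e) ` \<omega>"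

definition invariant_bond_perc :: "edge set measure \<Rightarrow> bool" where
  "invariant_bond_perc P \<longleftrightarrow> prob_space P \<and> sets P = sets z2_cfg \<and>
     (\<forall>\<phi>. z2_aut \<phi> \<longrightarrow> distr P P (act \<phi>) = P)"

definition clust :: "edge set \<Rightarrow> vtx \<Rightarrow> vtx set" where
  "clust F v = {w. (v, w) \<in> {(x, y). {x, y} \<in> F}\<^sup>*}"

definition is_cluster :: "edge set \<Rightarrow> vtx set \<Rightarrow> bool" where
  "is_cluster \<omega> C \<longleftrightarrow> (\<exists>v. C = clust \<omega> v)"

definition cl_edges :: "edge set \<Rightarrow> vtx set \<Rightarrow> edge set" where
  "cl_edges \<omega> C = {e \<in> \<omega>. e \<subseteq> C}"

definition bern :: "edge set \<Rightarrow> real \<Rightarrow> (edge \<Rightarrow> bool) measure" where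
  "bern EC p = PiM EC (\<lambda>_. measure_pmf (bernoulli_pmf p))"

definition has_inf_comp :: "edge set \<Rightarrow> bool" where
  "has_inf_comp G \<longleftrightarrow> (\<exists>v. infinite (clust G v))"

text \<open>Robust cluster: for some eps > 0, deleting each edge independently with
  probability eps leaves an infinite component with positive (outer) probability.\<close>
definition robust :: "edge set \<Rightarrow> vtx set \<Rightarrow> bool" where
  "robust \<omega> C \<longleftrightarrow> (\<exists>\<epsilon>::real. 0 < \<epsilon> \<and> \<epsilon> \<le> 1 \<and>
     \<not> (AE \<eta> in bern (cl_edges \<omega> C) (1 - \<epsilon>).
           \<not> has_inf_comp {e \<in> cl_edges \<omega> C. \<eta> e}))"

end

(* Thin the percolation by independent uniform edge labels, keeping an edge iff its label is at
   most some p < 1 close to 1. If three robust clusters existed with positive probability, the thinned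
   process, which is translation invariant and tolerates the deletion of finitely many edges, would
   have three infinite clusters with positive probability. Deleting all edges in the interior of a
   large square produces, with positive probability, a closed square whose boundary meets three
   infinite clusters, hence by invariance a positive density of such squares in a box. Contracting
   the clusters and the closed squares gives a planar bipartite graph in which every square has
   degree at least three, so by Euler's formula the number of squares is at most twice the number of
   clusters in the box, which is of the order of the box's boundary: a contradiction. *)
theory Submission
  imports Defs
begin

text \<open>In the original process an edge may be forced open by the rest of the configuration; an
  independent label above \<open>p\<close> can always close it, which is why thinning comes first.
  Three infinite components survive thinning together because distinct clusters have disjoint edge
  sets, so for a fixed configuration their survivals are independent. The robustness threshold
  depends on the configuration, hence a countable sequence of values \<open>p\<close> tending to 1
  is treated at once. As the last step argues for one fixed configuration, the set of configurations
  with three robust clusters never has to be shown measurable.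

  No planar graph is built. Contraction becomes a labelling of the vertices of a box, constant on
  infinite clusters and on interiors of closed squares, and Euler's formula becomes a bound on the
  excess of label changes around unit faces. Vertices of finite clusters adopt labels of neighbours,
  so that every monochromatic component contains a boundary vertex of the box or a closed square. A
  closed square yields excess 3 and costs 2; this is where three clusters beat two.\<close>

section \<open>Connected components of an edge set\<close>

lemma clust_refl: "v \<in> clust F v"
  by (simp add: clust_def)

lemma clust_edge: "{u, v} \<in> F \<Longrightarrow> v \<in> clust F u"
  by (auto simp: clust_def)

lemma clust_trans: "v \<in> clust F u \<Longrightarrow> w \<in> clust F v \<Longrightarrow> w \<in> clust F u"
  unfolding clust_def by (auto intro: rtrancl_trans)

lemma clust_step: "v \<in> clust F u \<Longrightarrow> {v, w} \<in> F \<Longrightarrow> w \<in> clust F u"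
  by (rule clust_trans[OF _ clust_edge])

lemma clust_sym: "v \<in> clust F u \<Longrightarrow> u \<in> clust F v"
proof -
  have "sym ({(x, y). {x, y} \<in> F}\<^sup>*)"
    by (rule sym_rtrancl) (auto simp: sym_def insert_commute)
  then show "v \<in> clust F u \<Longrightarrow> u \<in> clust F v"
    unfolding clust_def by (auto dest: symD)
qed

lemma clust_eq: "v \<in> clust F u \<Longrightarrow> clust F v = clust F u"
  using clust_sym clust_trans by blast

lemma clust_induct [consumes 1, case_names refl step]:
  assumes "w \<in> clust F v" "P v"
    and "\<And>x y. x \<in> clust F v \<Longrightarrow> {x, y} \<in> F \<Longrightarrow> P x \<Longrightarrow> P y"
  shows "P w"
proof -
  have "(v, w) \<in> {(x, y). {x, y} \<in> F}\<^sup>*"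
    using assms(1) by (simp add: clust_def)
  then show ?thesis
    by (induction rule: rtrancl_induct) (auto intro: assms(2) assms(3) simp: clust_def)
qed

lemma clust_subset:
  assumes "\<And>x y. x \<in> clust F u \<Longrightarrow> {x, y} \<in> F \<Longrightarrow> y \<in> clust F' x"
  shows "clust F u \<subseteq> clust F' u"
proof
  fix w assume "w \<in> clust F u"
  then show "w \<in> clust F' u"
  proof (induction rule: clust_induct)
    case (step x y)
    then show ?case
      using assms clust_trans by blast
  qed (rule clust_refl)
qed

lemma clust_mono: "F \<subseteq> F' \<Longrightarrow> clust F u \<subseteq> clust F' u"
  by (rule clust_subset) (auto intro: clust_edge)

text \<open>Every vertex outside \<open>R\<close> is charged to the first edge of a shortest path to \<open>R\<close>.\<close>

lemma card_le_roots_plus_edges: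
  assumes "finite V" "finite R" "finite F"
    and reach: "\<And>v. v \<in> V \<Longrightarrow> clust F v \<inter> R \<noteq> {}"
  shows "card V \<le> card R + card F"
proof -
  let ?r = "{(x, y). {x, y} \<in> F}"
  define reaches where "reaches v n \<longleftrightarrow> (\<exists>r\<in>R. (v, r) \<in> ?r ^^ n)" for v and n :: nat
  define d where "d v = (LEAST n. reaches v n)" for v
  have "\<exists>n. reaches v n" if "v \<in> V" for v
    using reach[OF that] by (auto simp: reaches_def clust_def rtrancl_power)
  then have atd: "reaches v (d v)" if "v \<in> V" for v
    unfolding d_def using that by (metis LeastI_ex)
  have "\<exists>w. {v, w} \<in> F \<and> d w < d v" if v: "v \<in> V - R" for v
  proof -
    obtain r where r: "r \<in> R" "(v, r) \<in> ?r ^^ (d v)"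
      using atd[of v] v unfolding reaches_def by blast
    have "d v \<noteq> 0"
    proof
      assume "d v = 0"
      then show False
        using r v by simp
    qed
    then obtain k where k: "d v = Suc k"
      using not0_implies_Suc by blast
    obtain w where w: "{v, w} \<in> F" "(w, r) \<in> ?r ^^ k"
      using r(2) k relpow_Suc_D2 by fastforce
    have "d w \<le> k"
      unfolding d_def using w r by (intro Least_le) (auto simp: reaches_def)
    then show ?thesis
      using w k by (intro exI[of _ w]) simp
  qed
  then obtain par where par: "\<And>v. v \<in> V - R \<Longrightarrow> {v, par v} \<in> F \<and> d (par v) < d v"
    by metis
  \<comment> \<open>If two vertices were charged to the same edge, each would be the parent of the
    other and the distance \<open>d\<close> to \<open>R\<close> would decrease in both
    directions.\<close>
  have "inj_on (\<lambda>v. {v, par v}) (V - R)"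
  proof (rule inj_onI)
    fix v w assume vw: "v \<in> V - R" "w \<in> V - R" "{v, par v} = {w, par w}"
    show "v = w"
      using par[OF vw(1)] par[OF vw(2)] vw(3) by (metis doubleton_eq_iff less_asym)
  qed
  then have "card (V - R) \<le> card F"
    using par assms by (intro card_inj_on_le) auto
  moreover have "card V \<le> card R + card (V - R)"
    using assms by (metis card_Diff_subset_Int card_mono diff_le_self finite_Int Int_lower2 le_diff_conv add.commute diff_card_le_card_Diff)
  ultimately show ?thesis by simp
qed

section \<open>Euler's inequality for labellings of a square grid\<close>

definition sq :: "int \<Rightarrow> vtx set" where
  "sq m = {0..m} \<times> {0..m}"

text \<open>The components are the monochromatic regions of \<open>V\<close>, which play the part of
  contracted vertices; the edges here may be open or closed in the percolation. A constant labelling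
  gives the induced lattice graph on \<open>V\<close>.\<close>

definition label_edges :: "(vtx \<Rightarrow> 'a) \<Rightarrow> vtx set \<Rightarrow> edge set" where
  "label_edges l V = {{u, v} | u v. z2_adj u v \<and> u \<in> V \<and> v \<in> V \<and> l u = l v}"

definition hchange :: "(vtx \<Rightarrow> 'a) \<Rightarrow> vtx \<Rightarrow> int" where
  "hchange l = (\<lambda>(x, y). of_bool (l (x, y) \<noteq> l (x + 1, y)))"

definition vchange :: "(vtx \<Rightarrow> 'a) \<Rightarrow> vtx \<Rightarrow> int" where
  "vchange l = (\<lambda>(x, y). of_bool (l (x, y) \<noteq> l (x, y + 1)))"

text \<open>In the dual lattice this is the degree, at the unit face with lower left corner (x, y),
  of the interface between different labels.\<close>

definition face_changes :: "(vtx \<Rightarrow> 'a) \<Rightarrow> vtx \<Rightarrow> int" where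
  "face_changes l = (\<lambda>(x, y).
     hchange l (x, y) + hchange l (x, y + 1) + vchange l (x, y) + vchange l (x + 1, y))"

text \<open>A single change around a closed walk would make the label differ from itself on
  return.\<close>

lemma face_changes_neq_1: "face_changes l f \<noteq> 1"
  by (cases f) (auto simp: face_changes_def hchange_def vchange_def of_bool_def)

lemma face_changes_eq_0:
  "face_changes l (x, y) = 0 \<longleftrightarrow>
     l (x, y) = l (x + 1, y) \<and> l (x, y + 1) = l (x + 1, y + 1) \<and>
     l (x, y) = l (x, y + 1) \<and> l (x + 1, y) = l (x + 1, y + 1)"
  by (simp add: face_changes_def hchange_def vchange_def of_bool_def)

lemma label_edges_cases:
  assumes "{u, v} \<in> label_edges l (sq m)"
  obtains (right) x y where "u = (x, y)" "v = (x + 1, y)" "0 \<le> x" "x < m" "0 \<le> y" "y \<le> m" "l u = l v"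
    | (left) x y where "v = (x, y)" "u = (x + 1, y)" "0 \<le> x" "x < m" "0 \<le> y" "y \<le> m" "l u = l v"
    | (up) x y where "u = (x, y)" "v = (x, y + 1)" "0 \<le> x" "x \<le> m" "0 \<le> y" "y < m" "l u = l v"
    | (down) x y where "v = (x, y)" "u = (x, y + 1)" "0 \<le> x" "x \<le> m" "0 \<le> y" "y < m" "l u = l v"
proof -
  obtain a b c d where ab: "u = (a, b)" "v = (c, d)"
    by (cases u, cases v) auto
  have "z2_adj u v" and m: "u \<in> sq m" "v \<in> sq m" and l: "l u = l v"
    using assms by (auto simp: label_edges_def doubleton_eq_iff z2_adj_def)
  then have "\<bar>a - c\<bar> + \<bar>b - d\<bar> = 1"
    by (simp add: z2_adj_def ab)
  then consider "c = a + 1" "b = d" | "a = c + 1" "b = d" | "a = c" "d = b + 1" | "a = c" "b = d + 1"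
    by linarith
  then show ?thesis
    using m l right left up down by cases (auto simp: sq_def ab)
qed

lemma card_zeros_plus_sum:
  fixes g :: "'a \<Rightarrow> int"
  assumes "finite A" "\<And>x. x \<in> A \<Longrightarrow> g x = 0 \<or> g x = 1"
  shows "int (card {x \<in> A. g x = 0}) + sum g A = int (card A)"
proof -
  have "int (card {x \<in> A. g x = 0}) = (\<Sum>x\<in>A. of_bool (g x = 0))"
    using assms(1) by (simp add: Int_def)
  also have "\<dots> + sum g A = (\<Sum>x\<in>A. 1)"
    unfolding sum.distrib[symmetric] using assms(2) by (intro sum.cong) auto
  finally show ?thesis by simp
qed

text \<open>Euler's formula as an inequality. Deleting the top edges of all monochromatic faces from the
  graph of monochromatic edges does not change its components: by induction on the height, a
  deleted edge is replaced by the path along the other three sides of the face below it.\<close>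

lemma excess_sum_le:
  assumes m: "0 \<le> m" and R: "finite R"
    and reach: "\<And>v. v \<in> sq m \<Longrightarrow> clust (label_edges l (sq m)) v \<inter> R \<noteq> {}"
  shows "(\<Sum>f\<in>{0..<m}\<times>{0..<m}. max 0 (face_changes l f - 2)) \<le> 2 * int (card R)"
proof -
  let ?D = "{0..<m} \<times> {0..<m}" and ?HD = "{0..<m} \<times> {0..m}" and ?VD = "{0..m} \<times> {0..<m}"
  let ?he = "\<lambda>(x, y). {(x, y), (x + 1, y)} :: edge" and ?ve = "\<lambda>(x, y). {(x, y), (x, y + 1)} :: edge"
  define F0 where "F0 = {f \<in> ?D. face_changes l f = 0}"
  define Ho where "Ho = {f \<in> ?HD. hchange l f = 0}"
  define Vo where "Vo = {f \<in> ?VD. vchange l f = 0}"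
  define T where "T = (\<lambda>(x, y). (x, y + 1)) ` F0"
  define F' where "F' = ?he ` (Ho - T) \<union> ?ve ` Vo"
  have fin: "finite F0" "finite Ho" "finite Vo" "finite T" "finite F'"
    by (auto simp: F0_def Ho_def Vo_def T_def F'_def)
  have cardT: "card T = card F0"
    unfolding T_def by (rule card_image) (auto simp: inj_on_def)
  have TH: "T \<subseteq> Ho"
    by (auto simp: T_def F0_def Ho_def face_changes_eq_0 hchange_def)
  have vert: "(x, y + 1) \<in> clust F' (x, y)"
    if "0 \<le> x" "x \<le> m" "0 \<le> y" "y < m" "l (x, y) = l (x, y + 1)" for x y
  proof (rule clust_edge)
    have "(x, y) \<in> Vo"
      using that by (auto simp: Vo_def vchange_def)
    then show "{(x, y), (x, y + 1)} \<in> F'"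
      unfolding F'_def by (intro UnI2 image_eqI[of _ _ "(x, y)"]) auto
  qed
  have hor: "(x + 1, int y) \<in> clust F' (x, int y)"
    if "0 \<le> x" "x < m" "int y \<le> m" "l (x, int y) = l (x + 1, int y)" for x y
    using that
  proof (induction y)
    case 0
    \<comment> \<open>Row 0 has no face of the box below it, so none of its edges is
      deleted.\<close>
    have "(x, 0) \<in> Ho - T"
      using 0 by (auto simp: Ho_def T_def hchange_def F0_def)
    then have "{(x, 0), (x + 1, 0)} \<in> F'"
      unfolding F'_def by (intro UnI1 image_eqI[of _ _ "(x, 0)"]) auto
    then show ?case
      by (auto intro: clust_edge)
  next
    case (Suc y)
    show ?case
    proof (cases "(x, int (Suc y)) \<in> T")
      case False
      then have "(x, int (Suc y)) \<in> Ho - T"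
        using Suc by (auto simp: Ho_def hchange_def)
      then have "{(x, int (Suc y)), (x + 1, int (Suc y))} \<in> F'"
        unfolding F'_def by (intro UnI1 image_eqI[of _ _ "(x, int (Suc y))"]) auto
      then show ?thesis
        by (rule clust_edge)
    next
      case True
      then have "face_changes l (x, int y) = 0"
        by (auto simp: T_def F0_def)
      then have e: "l (x, int y) = l (x + 1, int y)" "l (x, int y) = l (x, int y + 1)"
          "l (x + 1, int y) = l (x + 1, int y + 1)"
        by (simp_all add: face_changes_eq_0)
      have 1: "(x + 1, int y) \<in> clust F' (x, int y)"
        using Suc e by auto
      have 2: "(x, int y + 1) \<in> clust F' (x, int y)" "(x + 1, int y + 1) \<in> clust F' (x + 1, int y)"
        using vert[of x "int y"] vert[of "x + 1" "int y"] e Suc by auto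
      have "(x + 1, int y + 1) \<in> clust F' (x, int y + 1)"
        using 1 2 by (meson clust_sym clust_trans)
      then show ?thesis
        by (simp add: add.commute)
    qed
  qed
  have hor': "(x + 1, y) \<in> clust F' (x, y)"
    if "0 \<le> x" "x < m" "0 \<le> y" "y \<le> m" "l (x, y) = l (x + 1, y)" for x y
    using hor[of x "nat y"] that by simp
  have "clust (label_edges l (sq m)) v \<subseteq> clust F' v" for v
  proof (rule clust_subset)
    fix u w assume "{u, w} \<in> label_edges l (sq m)"
    then show "w \<in> clust F' u"
      by (cases rule: label_edges_cases) (use vert hor' in \<open>auto intro: clust_sym\<close>)
  qed
  then have "clust F' v \<inter> R \<noteq> {}" if "v \<in> sq m" for v
    using reach[OF that] by blast
  then have "card (sq m) \<le> card R + card F'"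
    using fin R by (intro card_le_roots_plus_edges) (auto simp: sq_def)
  also have "card F' \<le> (card Ho - card F0) + card Vo"
  proof -
    have "card F' \<le> card (?he ` (Ho - T)) + card (?ve ` Vo)"
      unfolding F'_def by (rule card_Un_le)
    also have "\<dots> \<le> card (Ho - T) + card Vo"
      using fin by (intro add_mono card_image_le) auto
    also have "card (Ho - T) = card Ho - card F0"
      using TH fin cardT by (simp add: card_Diff_subset)
    finally show ?thesis .
  qed
  finally have 1: "int (card (sq m)) + int (card F0) \<le> int (card R) + int (card Ho) + int (card Vo)"
    using card_mono[OF fin(2) TH] cardT by linarith
  have cb: "int (card (sq m)) = (m + 1) * (m + 1)"
    using m by (simp add: sq_def)
  have H: "int (card Ho) + (\<Sum>f\<in>?HD. hchange l f) = m * (m + 1)"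
    using m card_zeros_plus_sum[of ?HD "hchange l"] by (auto simp: Ho_def hchange_def)
  have V: "int (card Vo) + (\<Sum>f\<in>?VD. vchange l f) = (m + 1) * m"
    using m card_zeros_plus_sum[of ?VD "vchange l"] by (auto simp: Vo_def vchange_def)
  have nn: "0 \<le> hchange l f" "0 \<le> vchange l f" for f
    by (auto simp: hchange_def vchange_def split: prod.splits)
  \<comment> \<open>An edge is a side of at most two faces: each of the four positions (bottom,
    left, top, right) assigns edges to faces injectively.\<close>
  have "(\<Sum>(x,y)\<in>?D. hchange l (x, y)) \<le> (\<Sum>f\<in>?HD. hchange l f)"
    by (auto intro!: sum_mono2 nn)
  moreover have "(\<Sum>(x,y)\<in>?D. vchange l (x, y)) \<le> (\<Sum>f\<in>?VD. vchange l f)"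
    by (auto intro!: sum_mono2 nn)
  moreover have "(\<Sum>(x,y)\<in>?D. hchange l (x, y + 1)) \<le> (\<Sum>f\<in>?HD. hchange l f)"
  proof -
    have "(\<Sum>(x,y)\<in>?D. hchange l (x, y + 1)) = (\<Sum>f\<in>(\<lambda>(x,y). (x, y+1)) ` ?D. hchange l f)"
      by (subst sum.reindex) (auto simp: inj_on_def intro!: sum.cong)
    also have "\<dots> \<le> (\<Sum>f\<in>?HD. hchange l f)"
      by (intro sum_mono2 nn) auto
    finally show ?thesis .
  qed
  moreover have "(\<Sum>(x,y)\<in>?D. vchange l (x + 1, y)) \<le> (\<Sum>f\<in>?VD. vchange l f)"
  proof -
    have "(\<Sum>(x,y)\<in>?D. vchange l (x + 1, y)) = (\<Sum>f\<in>(\<lambda>(x,y). (x + 1, y)) ` ?D. vchange l f)"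
      by (subst sum.reindex) (auto simp: inj_on_def intro!: sum.cong)
    also have "\<dots> \<le> (\<Sum>f\<in>?VD. vchange l f)"
      by (intro sum_mono2 nn) auto
    finally show ?thesis .
  qed
  moreover have "(\<Sum>f\<in>?D. face_changes l f) = (\<Sum>(x,y)\<in>?D. hchange l (x, y)) + (\<Sum>(x,y)\<in>?D. hchange l (x, y + 1))
     + (\<Sum>(x,y)\<in>?D. vchange l (x, y)) + (\<Sum>(x,y)\<in>?D. vchange l (x + 1, y))"
    by (simp add: sum.distrib[symmetric] face_changes_def split_def)
  ultimately have 2: "(\<Sum>f\<in>?D. face_changes l f) \<le> 2 * (\<Sum>f\<in>?HD. hchange l f) + 2 * (\<Sum>f\<in>?VD. vchange l f)"
    by linarith
  \<comment> \<open>Since one change is impossible, truncation at 0 matters only for faces without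
    changes, where it adds 2.\<close>
  have "(\<Sum>f\<in>?D. max 0 (face_changes l f - 2)) = (\<Sum>f\<in>?D. face_changes l f - 2 + 2 * of_bool (f \<in> F0))"
  proof (rule sum.cong[OF refl])
    fix f assume "f \<in> ?D"
    moreover have "face_changes l f \<ge> 0"
      by (auto simp: face_changes_def split: prod.splits intro!: add_nonneg_nonneg nn)
    ultimately show "max 0 (face_changes l f - 2) = face_changes l f - 2 + 2 * of_bool (f \<in> F0)"
      using face_changes_neq_1[of l f] by (auto simp: F0_def)
  qed
  also have "\<dots> = (\<Sum>f\<in>?D. face_changes l f) - 2 * (m * m) + 2 * int (card F0)"
  proof -
    have "(\<Sum>f\<in>?D. of_bool (f \<in> F0) :: int) = int (card F0)"
      by (subst sum.mono_neutral_right[of ?D F0]) (auto simp: F0_def)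
    then show ?thesis
      using m by (simp add: sum.distrib sum_subtractf sum_distrib_left[symmetric])
  qed
  \<comment> \<open>With E = |Ho| + |Vo| the total number of changes is at most 2 (2 m (m + 1) - E),
    and E is at least (m + 1)^2 + |F0| - |R|. The quadratic terms and |F0| cancel, leaving 2 |R| -
    2.\<close>
  also have "\<dots> \<le> 2 * int (card R)"
    using 1 2 H V cb by (simp add: algebra_simps)
  finally show ?thesis .
qed

section \<open>Closed squares meeting three infinite clusters\<close>

definition cell :: "int \<Rightarrow> vtx \<Rightarrow> vtx set" where
  "cell L a = {fst a..fst a + L} \<times> {snd a..snd a + L}"

definition core :: "int \<Rightarrow> vtx \<Rightarrow> vtx set" where
  "core L a = {fst a<..<fst a + L} \<times> {snd a<..<snd a + L}"

definition frame :: "int \<Rightarrow> vtx \<Rightarrow> vtx set" where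
  "frame L a = cell L a - core L a"

text \<open>Only edges with an endpoint in the interior are closed. Edges along the frame may be
  open, so neighbouring cells can share a side of their frames.\<close>

definition good :: "int \<Rightarrow> vtx \<Rightarrow> edge set \<Rightarrow> bool" where
  "good L a \<omega> \<longleftrightarrow> (\<forall>e\<in>\<omega>. e \<inter> core L a = {}) \<and>
     (\<exists>v1\<in>frame L a. \<exists>v2\<in>frame L a. \<exists>v3\<in>frame L a.
        infinite (clust \<omega> v1) \<and> infinite (clust \<omega> v2) \<and> infinite (clust \<omega> v3) \<and>
        clust \<omega> v1 \<noteq> clust \<omega> v2 \<and> clust \<omega> v1 \<noteq> clust \<omega> v3 \<and> clust \<omega> v2 \<noteq> clust \<omega> v3)"

lemma change_between:
  fixes g :: "int \<Rightarrow> 'a"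
  assumes "a \<le> b" "g a \<noteq> g b"
  shows "\<exists>k\<in>{a..<b}. g k \<noteq> g (k + 1)"
  using assms
proof (induction b rule: int_ge_induct)
  case (step i)
  then show ?case
    by (cases "g a = g i") (auto intro: bexI[of _ i])
qed simp

text \<open>The three positions cut the cycle into three arcs whose ends carry different values, so
  each arc contains a change. The arc through the origin is closed up by
  \<open>g N = g 0\<close>.\<close>

lemma three_changes:
  fixes g :: "int \<Rightarrow> 'a"
  assumes "g N = g 0" and "p \<in> {0..<N}" "q \<in> {0..<N}" "r \<in> {0..<N}"
    and "g p \<noteq> g q" "g p \<noteq> g r" "g q \<noteq> g r"
  shows "3 \<le> (\<Sum>k\<in>{0..<N}. of_bool (g k \<noteq> g (k + 1)) :: int)"
proof -
  have ordered: ?thesis if abc: "a < b" "b < c" "0 \<le> a" "c < N" "g a \<noteq> g b" "g b \<noteq> g c" "g a \<noteq> g c" for a b c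
  proof -
    obtain k1 where k1: "k1 \<in> {a..<b}" "g k1 \<noteq> g (k1 + 1)"
      using change_between[of a b g] abc by fastforce
    obtain k2 where k2: "k2 \<in> {b..<c}" "g k2 \<noteq> g (k2 + 1)"
      using change_between[of b c g] abc by fastforce
    have "\<exists>k\<in>{0..<a} \<union> {c..<N}. g k \<noteq> g (k + 1)"
    proof (cases "g c = g N")
      case True
      then have "g 0 \<noteq> g a"
        using abc assms by auto
      then show ?thesis
        using change_between[of 0 a g] abc by blast
    next
      case False
      then show ?thesis
        using change_between[of c N g] abc by fastforce
    qed
    then obtain k3 where k3: "k3 \<in> {0..<a} \<union> {c..<N}" "g k3 \<noteq> g (k3 + 1)"
      by blast
    have "(\<Sum>k\<in>{k1, k2, k3}. of_bool (g k \<noteq> g (k + 1)) :: int) \<le> (\<Sum>k\<in>{0..<N}. of_bool (g k \<noteq> g (k + 1)))"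
      using k1 k2 k3 abc by (intro sum_mono2) auto
    moreover have "k1 \<noteq> k2" "k1 \<noteq> k3" "k2 \<noteq> k3"
      using k1 k2 k3 abc by auto
    ultimately show ?thesis
      using k1 k2 k3 by simp
  qed
  consider "p < q" "q < r" | "p < r" "r < q" | "q < p" "p < r" | "q < r" "r < p" | "r < p" "p < q" | "r < q" "q < p"
    using assms by (metis linorder_neqE)
  then show ?thesis
    by cases (use ordered[of p q r] ordered[of p r q] ordered[of q p r] ordered[of q r p]
        ordered[of r p q] ordered[of r q p] assms in auto)
qed

text \<open>A face touching the frame has exactly two changes between frame and core, and the 2
  subtracted in the excess absorbs them. What remains are the changes along the frame, and going
  once around it meets at least three.\<close>

lemma frame_excess_origin:
  assumes L: "2 \<le> L" and inn: "\<And>v. v \<in> core L (0, 0) \<Longrightarrow> l v = c"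
    and fr: "\<And>v. v \<in> frame L (0, 0) \<Longrightarrow> l v \<noteq> c"
    and three: "v1 \<in> frame L (0, 0)" "v2 \<in> frame L (0, 0)" "v3 \<in> frame L (0, 0)"
      "l v1 \<noteq> l v2" "l v1 \<noteq> l v3" "l v2 \<noteq> l v3"
  shows "3 \<le> (\<Sum>f\<in>{0..<L}\<times>{0..<L}. max 0 (face_changes l f - 2))"
proof -
  let ?I = "{0..<L}"
  \<comment> \<open>The perimeter walked counterclockwise from the lower left corner, with period
    \<open>4 * L\<close>.\<close>
  define cyc :: "int \<Rightarrow> vtx" where
    "cyc k = (if k \<le> L then (k, 0) else if k \<le> 2 * L then (L, k - L)
       else if k \<le> 3 * L then (3 * L - k, L) else (0, 4 * L - k))" for k
  define ch :: "int \<Rightarrow> int" where "ch k = of_bool (l (cyc k) \<noteq> l (cyc (k + 1)))" for k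
  have cov: "\<exists>k\<in>{0..<4 * L}. v = cyc k" if fv: "v \<in> frame L (0, 0)" for v
  proof -
    obtain x y where v: "v = (x, y)" by (cases v)
    have b: "0 \<le> x" "x \<le> L" "0 \<le> y" "y \<le> L" and "x = 0 \<or> x = L \<or> y = 0 \<or> y = L"
      using fv by (auto simp: frame_def cell_def core_def v)
    then consider "y = 0" | "x = L" "y \<noteq> 0" | "y = L" "x \<noteq> L" | "x = 0" "y \<noteq> 0" "y \<noteq> L"
      by blast
    then show ?thesis
    proof cases
      case 1
      then show ?thesis using L b by (intro bexI[of _ x]) (auto simp: v cyc_def)
    next
      case 2
      then show ?thesis using L b by (intro bexI[of _ "L + y"]) (auto simp: v cyc_def)
    next
      case 3
      then show ?thesis using L b by (intro bexI[of _ "3 * L - x"]) (auto simp: v cyc_def)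
    next
      case 4
      then show ?thesis using L b by (intro bexI[of _ "4 * L - y"]) (auto simp: v cyc_def)
    qed
  qed
  obtain p q r where pqr: "p \<in> {0..<4 * L}" "q \<in> {0..<4 * L}" "r \<in> {0..<4 * L}"
      "v1 = cyc p" "v2 = cyc q" "v3 = cyc r"
    using cov three by metis
  have "3 \<le> (\<Sum>k\<in>{0..<4 * L}. ch k)"
    unfolding ch_def
    by (rule three_changes[of "\<lambda>k. l (cyc k)" _ p q r]) (use pqr three L in \<open>auto simp: cyc_def\<close>)
  also have "{0..<4 * L} = {0..<L} \<union> {L..<2 * L} \<union> {2 * L..<3 * L} \<union> {3 * L..<4 * L}"
    using L by auto
  also have "sum ch \<dots> = sum ch {0..<L} + sum ch {L..<2 * L} + sum ch {2 * L..<3 * L} + sum ch {3 * L..<4 * L}"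
    by (subst sum.union_disjoint; (subst sum.union_disjoint)?; (subst sum.union_disjoint)?; auto)
  also have "sum ch {0..<L} = (\<Sum>x\<in>?I. hchange l (x, 0))"
    by (rule sum.cong) (auto simp: ch_def cyc_def hchange_def)
  also have "sum ch {L..<2 * L} = (\<Sum>y\<in>?I. vchange l (L, y))"
    by (rule sum.reindex_bij_witness[of _ "\<lambda>y. y + L" "\<lambda>k. k - L"])
       (auto simp: ch_def cyc_def vchange_def algebra_simps)
  also have "sum ch {2 * L..<3 * L} = (\<Sum>x\<in>?I. hchange l (x, L))"
    by (rule sum.reindex_bij_witness[of _ "\<lambda>x. 3 * L - 1 - x" "\<lambda>k. 3 * L - 1 - k"])
       (use L in \<open>auto simp: ch_def cyc_def hchange_def algebra_simps\<close>)
  also have "sum ch {3 * L..<4 * L} = (\<Sum>y\<in>?I. vchange l (0, y))"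
    by (rule sum.reindex_bij_witness[of _ "\<lambda>x. 4 * L - 1 - x" "\<lambda>k. 4 * L - 1 - k"])
       (use L in \<open>auto simp: ch_def cyc_def vchange_def algebra_simps\<close>)
  finally have 1: "3 \<le> (\<Sum>x\<in>?I. hchange l (x, 0)) + (\<Sum>y\<in>?I. vchange l (L, y)) +
      (\<Sum>x\<in>?I. hchange l (x, L)) + (\<Sum>y\<in>?I. vchange l (0, y))" .
  \<comment> \<open>The changes on those sides of the face (x, y) that lie on the frame. Each frame
    edge is a side of exactly one face of the cell, so summing over faces counts it once.\<close>
  let ?w = "\<lambda>x y. (if y = 0 then hchange l (x, 0) else 0) + (if x = L - 1 then vchange l (L, y) else 0)
     + (if y = L - 1 then hchange l (x, L) else 0) + (if x = 0 then vchange l (0, y) else 0)"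
  have "(\<Sum>x\<in>?I. \<Sum>y\<in>?I. ?w x y) = (\<Sum>x\<in>?I. \<Sum>y\<in>?I. if y = 0 then hchange l (x, 0) else 0)
     + (\<Sum>y\<in>?I. \<Sum>x\<in>?I. if x = L - 1 then vchange l (L, y) else 0)
     + (\<Sum>x\<in>?I. \<Sum>y\<in>?I. if y = L - 1 then hchange l (x, L) else 0)
     + (\<Sum>y\<in>?I. \<Sum>x\<in>?I. if x = 0 then vchange l (0, y) else 0)"
    by (subst (2 4) sum.swap) (simp add: sum.distrib)
  also have "\<dots> = (\<Sum>x\<in>?I. hchange l (x, 0)) + (\<Sum>y\<in>?I. vchange l (L, y)) +
      (\<Sum>x\<in>?I. hchange l (x, L)) + (\<Sum>y\<in>?I. vchange l (0, y))"
    using L by (simp add: sum.delta)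
  finally have 2: "(\<Sum>x\<in>?I. \<Sum>y\<in>?I. ?w x y) = \<dots>" .
  have cw: "?w x y \<le> max 0 (face_changes l (x, y) - 2)" if xy: "x \<in> ?I" "y \<in> ?I" for x y
  proof -
    have inn': "l (s, t) = c" if "0 < s" "s < L" "0 < t" "t < L" for s t
      using inn that by (auto simp: core_def)
    have fr': "l (s, t) \<noteq> c" if "0 \<le> s" "s \<le> L" "0 \<le> t" "t \<le> L" "s = 0 \<or> s = L \<or> t = 0 \<or> t = L" for s t
      using fr[of "(s, t)"] that by (auto simp: core_def frame_def cell_def)
    have xc: "x = 0 \<or> x = L - 1 \<or> (0 < x \<and> x + 1 < L)" and yc: "y = 0 \<or> y = L - 1 \<or> (0 < y \<and> y + 1 < L)"
      using xy by auto
    have lab: "l (x, y) = c \<longleftrightarrow> x \<noteq> 0 \<and> y \<noteq> 0" "l (x + 1, y) = c \<longleftrightarrow> x \<noteq> L - 1 \<and> y \<noteq> 0"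
      "l (x, y + 1) = c \<longleftrightarrow> x \<noteq> 0 \<and> y \<noteq> L - 1" "l (x + 1, y + 1) = c \<longleftrightarrow> x \<noteq> L - 1 \<and> y \<noteq> L - 1"
      using xy L inn'[of x y] inn'[of "x + 1" y] inn'[of x "y + 1"] inn'[of "x + 1" "y + 1"]
        fr'[of x y] fr'[of "x + 1" y] fr'[of x "y + 1"] fr'[of "x + 1" "y + 1"]
      by auto
    show ?thesis
      using xc yc L lab
      by (elim disjE) (auto simp: face_changes_def hchange_def vchange_def of_bool_def)
  qed
  have "(\<Sum>x\<in>?I. \<Sum>y\<in>?I. ?w x y) \<le> (\<Sum>x\<in>?I. \<Sum>y\<in>?I. max 0 (face_changes l (x, y) - 2))"
    by (intro sum_mono cw)
  then show ?thesis
    using 1 2 by (simp add: sum.cartesian_product split_def)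
qed

lemma frame_excess:
  assumes L: "2 \<le> L" and inn: "\<And>v. v \<in> core L (a, b) \<Longrightarrow> l v = c"
    and fr: "\<And>v. v \<in> frame L (a, b) \<Longrightarrow> l v \<noteq> c"
    and three: "v1 \<in> frame L (a, b)" "v2 \<in> frame L (a, b)" "v3 \<in> frame L (a, b)"
      "l v1 \<noteq> l v2" "l v1 \<noteq> l v3" "l v2 \<noteq> l v3"
  shows "3 \<le> (\<Sum>f\<in>{a..<a + L}\<times>{b..<b + L}. max 0 (face_changes l f - 2))"
proof -
  let ?s = "\<lambda>(x, y). (x + a, y + b)" and ?t = "\<lambda>(x, y). (x - a, y - b)"
  have shift: "v \<in> core L (0, 0) \<longleftrightarrow> ?s v \<in> core L (a, b)" "v \<in> frame L (0, 0) \<longleftrightarrow> ?s v \<in> frame L (a, b)" for v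
    by (cases v; auto simp: core_def frame_def cell_def)+
  have st: "?s (?t v) = v" for v
    by (cases v) auto
  have "3 \<le> (\<Sum>f\<in>{0..<L}\<times>{0..<L}. max 0 (face_changes (l \<circ> ?s) f - 2))"
    by (rule frame_excess_origin[of L "l \<circ> ?s" c "?t v1" "?t v2" "?t v3"])
       (use assms st shift in \<open>simp_all only: o_apply not_False_eq_True simp_thms\<close>)
  also have "\<dots> = (\<Sum>f\<in>{a..<a + L}\<times>{b..<b + L}. max 0 (face_changes l f - 2))"
    by (rule sum.reindex_bij_witness[of _ "?t" "?s"])
       (auto simp: face_changes_def hchange_def vchange_def algebra_simps)
  finally show ?thesis .
qed

section \<open>Labelling a box by infinite clusters and closed squares\<close>

lemma clust_untouched:
  assumes "\<And>e. e \<in> \<omega> \<Longrightarrow> v \<notin> e"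
  shows "clust \<omega> v = {v}"
proof -
  have "w = v" if "w \<in> clust \<omega> v" for w
    using that by (induction rule: clust_induct) (use assms in auto)
  then show ?thesis
    using clust_refl by blast
qed

text \<open>Unlabelled vertices successively adopt the label of a labelled neighbour.\<close>

lemma extend_labels:
  assumes "finite X" "Y \<subseteq> X" "Y \<noteq> {}"
    and conn: "\<And>x. x \<in> X \<Longrightarrow> x0 \<in> clust (label_edges (\<lambda>_. ()) X) x"
  shows "\<exists>l. (\<forall>y\<in>Y. l y = l0 y) \<and> (\<forall>x\<in>X. \<exists>y\<in>Y. y \<in> clust (label_edges l X) x \<and> l y = l x)"
  using assms(2, 3)
proof (induction "card (X - Y)" arbitrary: Y l0 rule: less_induct)
  case less
  show ?case
  proof (cases "Y = X")
    case True
    then show ?thesis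
      by (intro exI[of _ l0]) (auto intro: clust_refl)
  next
    case False
    \<comment> \<open>Otherwise no lattice edge inside \<open>X\<close> would leave
      \<open>X - Y\<close>, although \<open>conn\<close> makes the induced graph on \<open>X\<close>
      connected.\<close>
    have "\<exists>y\<in>Y. \<exists>x\<in>X - Y. z2_adj x y"
    proof (rule ccontr)
      assume no: "\<not> ?thesis"
      obtain y z where yz: "y \<in> Y" "z \<in> X - Y"
        using less.prems False by auto
      have "y \<in> clust (label_edges (\<lambda>_. ()) X) z"
        using conn[of y] conn[of z] yz less.prems clust_sym clust_trans by blast
      then have "y \<in> X - Y"
      proof (induction rule: clust_induct)
        case refl
        then show ?case using yz by simp
      next
        case (step a b)
        then have "z2_adj a b" "b \<in> X"
          by (auto simp: label_edges_def doubleton_eq_iff z2_adj_def)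
        then show ?case
          using step no by blast
      qed
      then show False
        using yz by simp
    qed
    then obtain x y where xy: "y \<in> Y" "x \<in> X - Y" "z2_adj x y"
      by blast
    have "card (X - insert x Y) < card (X - Y)"
      using xy assms(1) by (intro psubset_card_mono) auto
    then obtain l where l: "\<And>z. z \<in> insert x Y \<Longrightarrow> l z = (l0(x := l0 y)) z"
      and r: "\<And>z. z \<in> X \<Longrightarrow> \<exists>y\<in>insert x Y. y \<in> clust (label_edges l X) z \<and> l y = l z"
      using less.hyps[of "insert x Y" "l0(x := l0 y)"] less.prems xy by (metis DiffD1 insert_not_empty insert_subset)
    have ly: "l x = l y" "x \<noteq> y"
      using l[of x] l[of y] xy by auto
    have xcy: "y \<in> clust (label_edges l X) x"
    proof (rule clust_edge)
      show "{x, y} \<in> label_edges l X"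
        using xy less.prems ly unfolding label_edges_def by blast
    qed
    have "\<exists>y\<in>Y. y \<in> clust (label_edges l X) z \<and> l y = l z" if "z \<in> X" for z
      using r[OF that] xcy ly xy clust_trans by (metis insertE)
    moreover have "\<forall>y\<in>Y. l y = l0 y"
      using l xy by auto
    ultimately show ?thesis by blast
  qed
qed

text \<open>Walk left along the row, then down the first column. This serves both for grid
  connectivity under the constant labelling and for the interiors of closed squares, which carry a
  single label.\<close>

lemma rectangle_connected:
  assumes "{p..q} \<times> {r..s} \<subseteq> V" "\<And>v w. v \<in> {p..q} \<times> {r..s} \<Longrightarrow> w \<in> {p..q} \<times> {r..s} \<Longrightarrow> l v = l w"
    and "p \<le> x" "x \<le> q" "r \<le> y" "y \<le> s"
  shows "(p, r) \<in> clust (label_edges l V) (x, y)"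
proof -
  have 1: "(p, y) \<in> clust (label_edges l V) (x, y)"
    using \<open>p \<le> x\<close> \<open>x \<le> q\<close>
  proof (induction x rule: int_ge_induct)
    case (step i)
    have "{(i + 1, y), (i, y)} \<in> label_edges l V"
      unfolding label_edges_def z2_adj_def using step assms
      by (intro CollectI exI[of _ "(i + 1, y)"] exI[of _ "(i, y)"]) auto
    then show ?case
      using step by (auto intro: clust_trans clust_edge)
  qed (rule clust_refl)
  have 2: "(p, r) \<in> clust (label_edges l V) (p, y)"
    using \<open>r \<le> y\<close> \<open>y \<le> s\<close>
  proof (induction y rule: int_ge_induct)
    case (step i)
    have "{(p, i + 1), (p, i)} \<in> label_edges l V"
      unfolding label_edges_def z2_adj_def using step assms
      by (intro CollectI exI[of _ "(p, i + 1)"] exI[of _ "(p, i)"]) auto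
    then show ?case
      using step by (auto intro: clust_trans clust_edge)
  qed (rule clust_refl)
  show ?thesis
    by (rule clust_trans[OF 1 2])
qed

text \<open>In terms of quotient and remainder, the disjointness of different cores and the
  avoidance of the grid lines become arithmetic.\<close>

lemma core_div_mod:
  assumes "0 < L"
  shows "(x, y) \<in> core L (i * L, j * L) \<longleftrightarrow> x div L = i \<and> x mod L \<noteq> 0 \<and> y div L = j \<and> y mod L \<noteq> 0"
proof -
  have *: "i * L < x \<and> x < i * L + L \<longleftrightarrow> x div L = i \<and> x mod L \<noteq> 0" for x i
  proof
    assume a: "i * L < x \<and> x < i * L + L"
    then have "x div L = i"
      by (intro int_div_pos_eq[of _ _ _ "x - i * L"]) (auto simp: algebra_simps)
    moreover have "x = x div L * L + x mod L"
      by simp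
    ultimately show "x div L = i \<and> x mod L \<noteq> 0"
      using a by (metis add.right_neutral less_irrefl)
  next
    assume a: "x div L = i \<and> x mod L \<noteq> 0"
    have "x = x div L * L + x mod L"
      by simp
    moreover have "0 \<le> x mod L" "x mod L < L"
      using assms by auto
    ultimately show "i * L < x \<and> x < i * L + L"
      using a by (metis add_less_cancel_left add.right_neutral le_less)
  qed
  show ?thesis
    using *[of i x] *[of j y] by (auto simp: core_def)
qed

definition rim :: "int \<Rightarrow> vtx set" where
  "rim m = {v \<in> sq m. fst v = 0 \<or> fst v = m \<or> snd v = 0 \<or> snd v = m}"

lemma card_rim: 
  assumes "0 \<le> m"
  shows "int (card (rim m)) \<le> 4 * (m + 1)"
proof -
  let ?A = "{0, m} \<times> {0..m}" and ?B = "{0..m} \<times> {0, m}"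
  have "rim m \<subseteq> ?A \<union> ?B"
    by (auto simp: rim_def sq_def)
  then have "card (rim m) \<le> card (?A \<union> ?B)"
    by (intro card_mono) auto
  also have "\<dots> \<le> card ?A + card ?B"
    by (rule card_Un_le)
  also have "\<dots> = 2 * (card {0, m} * nat (m + 1))"
    by (simp add: card_cartesian_product)
  also have "\<dots> \<le> 2 * (2 * nat (m + 1))"
    by (intro mult_le_mono order_refl) (simp add: card_insert_if)
  finally have "int (card (rim m)) \<le> 4 * int (nat (m + 1))"
    by linarith
  then show ?thesis
    using assms by simp
qed

text \<open>An infinite cluster must leave the box. Up to its first visit to the rim, an open path
  from \<open>v\<close> stays in the box and sees only the label of its own cluster, so it is also a
  path of \<open>label_edges\<close>.\<close>

lemma reach_rim:
  assumes \<omega>: "\<omega> \<subseteq> Z2E" and v: "v \<in> sq m" "infinite (clust \<omega> v)"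
    and lab: "\<And>u. u \<in> sq m \<Longrightarrow> infinite (clust \<omega> u) \<Longrightarrow> l u = clust \<omega> u"
  shows "clust (label_edges l (sq m)) v \<inter> rim m \<noteq> {}"
proof -
  let ?E = "label_edges l (sq m)"
  have dichotomy: "(w \<in> sq m \<and> w \<in> clust ?E v) \<or> clust ?E v \<inter> rim m \<noteq> {}" if "w \<in> clust \<omega> v" for w
    using that
  proof (induction rule: clust_induct)
    case refl
    then show ?case using v clust_refl by blast
  next
    case (step x y)
    have "{x, y} \<in> Z2E"
      using step \<omega> by auto
    then have adj: "z2_adj x y"
      by (auto simp: Z2E_def doubleton_eq_iff z2_adj_def)
    show ?case
    proof (cases "clust ?E v \<inter> rim m \<noteq> {}")
      case False
      then have x: "x \<in> sq m" "x \<in> clust ?E v" "x \<notin> rim m"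
        using step by auto
      then have y: "y \<in> sq m"
        using adj by (cases x; cases y) (auto simp: sq_def rim_def z2_adj_def)
      have "clust \<omega> x = clust \<omega> v" "clust \<omega> y = clust \<omega> v"
        using step clust_eq clust_step by blast+
      then have "l x = l y"
        using lab x y v by simp
      then have "{x, y} \<in> ?E"
        using adj x y unfolding label_edges_def by blast
      then show ?thesis
        using x y clust_step by blast
    qed simp
  qed
  have "finite (sq m)"
    by (simp add: sq_def)
  then obtain w where "w \<in> clust \<omega> v" "w \<notin> sq m"
    using v by (meson finite_subset subsetI)
  then show ?thesis
    using dichotomy by blast
qed

text \<open>The streets, lines with a coordinate divisible by \<open>L\<close>, are never removed
  and are connected to each other. A vertex off the streets lies in a core that was kept, and can
  walk left to a street without leaving its cell.\<close>

lemma street_grid_connected: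
  assumes L: "0 < L" and X: "X = sq (n * L) - (\<Union>(i, j)\<in>G. core L (i * L, j * L))"
    and v: "v \<in> X"
  shows "(0, 0) \<in> clust (label_edges (\<lambda>_. ()) X) v"
proof -
  let ?E = "label_edges (\<lambda>_. ()) X"
  obtain x y where xy: "v = (x, y)" by (cases v)
  have b: "0 \<le> x" "x \<le> n * L" "0 \<le> y" "y \<le> n * L"
    using v X by (auto simp: xy sq_def)
  have inX: "(s, t) \<in> X \<longleftrightarrow> (s, t) \<in> sq (n * L) \<and> \<not> (s mod L \<noteq> 0 \<and> t mod L \<noteq> 0 \<and> (s div L, t div L) \<in> G)" for s t
    using L by (auto simp: X core_div_mod)
  have row: "(0, t) \<in> clust ?E (s, t)" if "t mod L = 0" "0 \<le> s" "s \<le> n * L" "0 \<le> t" "t \<le> n * L" for s t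
    by (rule rectangle_connected[of 0 "n * L" t t]) (use that in \<open>auto simp: inX sq_def\<close>)
  have col: "(s, 0) \<in> clust ?E (s, t)" if "s mod L = 0" "0 \<le> s" "s \<le> n * L" "0 \<le> t" "t \<le> n * L" for s t
    by (rule rectangle_connected[of s s 0 "n * L"]) (use that in \<open>auto simp: inX sq_def\<close>)
  have streets: "(0, 0) \<in> clust ?E (s, t)" if "s mod L = 0 \<or> t mod L = 0" "0 \<le> s" "s \<le> n * L" "0 \<le> t" "t \<le> n * L" for s t
  proof (cases "s mod L = 0")
    case True
    then show ?thesis
      using that clust_trans[OF col[of s t] row[of 0 s]] by simp
  next
    case False
    then show ?thesis
      using that clust_trans[OF row[of t s] col[of 0 t]] by simp
  qed
  show ?thesis
  proof (cases "x mod L = 0 \<or> y mod L = 0")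
    case True
    then show ?thesis
      using streets[of x y] b xy by simp
  next
    case False
    then have nG: "(x div L, y div L) \<notin> G"
      using v inX xy by auto
    let ?s = "x div L * L"
    have s: "0 \<le> ?s" "?s \<le> x"
      using b L by (simp_all add: pos_imp_zdiv_nonneg_iff minus_mod_eq_div_mult[symmetric] zmod_le_nonneg_dividend)
    have dv: "t div L = x div L" if "?s \<le> t" "t \<le> x" for t
      using that L s zdiv_mono1[of t x L] zdiv_mono1[of ?s t L] by simp
    have "(?s, y) \<in> clust ?E (x, y)"
    proof (rule rectangle_connected[of ?s x y y])
      have "(t, y) \<in> X" if "?s \<le> t" "t \<le> x" for t
        using b s nG dv[OF that] that by (simp add: inX sq_def)
      then show "{?s..x} \<times> {y..y} \<subseteq> X"
        by auto
    qed (use s in simp_all)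
    moreover have "(0, 0) \<in> clust ?E (?s, y)"
      using streets[of ?s y] s b by auto
    ultimately show ?thesis
      using clust_trans xy by blast
  qed
qed

text \<open>Each good cell has excess at least 3 but adds only one root, worth 2 in
  \<open>excess_sum_le\<close>. Thus 3 |G| <= 2 (|rim| + |G|), so |G| is at most twice the size of
  the rim, which has at most 4 (m + 1) vertices.\<close>

lemma card_good_cells_le:
  assumes \<omega>: "\<omega> \<subseteq> Z2E" and L: "2 \<le> L" and n: "0 \<le> n"
  shows "int (card {(i, j) \<in> {0..<n} \<times> {0..<n}. good L (i * L, j * L) \<omega>}) \<le> 8 * (n * L + 1)"
\<comment> \<open>Without a good cell there may be no infinite cluster in the box, and
  \<open>extend_labels\<close> needs a nonempty set of initial labels.\<close>
proof (cases "{(i, j) \<in> {0..<n} \<times> {0..<n}. good L (i * L, j * L) \<omega>} = {}")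
  case True
  then show ?thesis
    using n L unfolding True by simp
next
  case False
  define G where "G = {(i, j) \<in> {0..<n} \<times> {0..<n}. good L (i * L, j * L) \<omega>}"
  define m where "m = n * L"
  define X where "X = sq m - (\<Union>(i, j)\<in>G. core L (i * L, j * L))"
  define Y where "Y = {v \<in> sq m. infinite (clust \<omega> v)}"
  have fin: "finite G" "finite (sq m)" "finite X"
    by (auto simp: G_def sq_def X_def intro: finite_subset[of _ "{0..<n} \<times> {0..<n}"])
  have m0: "0 \<le> m"
    using n L by (simp add: m_def)
  have inX: "(s, t) \<in> X \<longleftrightarrow> (s, t) \<in> sq m \<and> \<not> (s mod L \<noteq> 0 \<and> t mod L \<noteq> 0 \<and> (s div L, t div L) \<in> G)" for s t
    using L by (auto simp: X_def core_div_mod)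
  have cell_sq: "cell L (i * L, j * L) \<subseteq> sq m" if "(i, j) \<in> G" for i j
  proof -
    have "0 \<le> i" "i + 1 \<le> n" "0 \<le> j" "j + 1 \<le> n"
      using that by (auto simp: G_def)
    then have "0 \<le> i * L" "(i + 1) * L \<le> m" "0 \<le> j * L" "(j + 1) * L \<le> m"
      using L unfolding m_def by (auto intro: mult_right_mono)
    then show ?thesis
      by (auto simp: cell_def sq_def algebra_simps)
  qed
  have frX: "frame L (i * L, j * L) \<subseteq> X" if "(i, j) \<in> G" for i j
  proof
    fix v assume v: "v \<in> frame L (i * L, j * L)"
    obtain x y where xy: "v = (x, y)" by (cases v)
    have "x = i * L \<or> x = (i + 1) * L \<or> y = j * L \<or> y = (j + 1) * L"
      using v by (auto simp: xy frame_def cell_def core_def algebra_simps)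
    then have "x mod L = 0 \<or> y mod L = 0"
      by auto
    then show "v \<in> X"
      using v cell_sq[OF that] by (auto simp: xy inX frame_def)
  qed
  \<comment> \<open>Vertices inside a closed square are isolated, so no infinite cluster contains
    them.\<close>
  have YX: "Y \<subseteq> X"
  proof
    fix v assume v: "v \<in> Y"
    have "v \<notin> core L (i * L, j * L)" if "(i, j) \<in> G" for i j
    proof
      assume "v \<in> core L (i * L, j * L)"
      then have "clust \<omega> v = {v}"
        using that by (intro clust_untouched) (auto simp: G_def good_def)
      then show False
        using v by (simp add: Y_def)
    qed
    then show "v \<in> X"
      using v by (auto simp: X_def Y_def)
  qed
  have Y0: "Y \<noteq> {}"
  proof -
    obtain i j where ij: "(i, j) \<in> G"
      using False G_def by auto
    then obtain v where "v \<in> frame L (i * L, j * L)" "infinite (clust \<omega> v)"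
      by (auto simp: G_def good_def)
    then show ?thesis
      using cell_sq[OF ij] unfolding Y_def frame_def by blast
  qed
  have "(0, 0) \<in> clust (label_edges (\<lambda>_. ()) X) x" if "x \<in> X" for x
    by (rule street_grid_connected[of L X n G]) (use that L in \<open>simp_all add: X_def m_def\<close>)
  from extend_labels[OF fin(3) YX Y0 this, of "clust \<omega>"]
  obtain l where l: "\<And>y. y \<in> Y \<Longrightarrow> l y = clust \<omega> y"
    and lr: "\<And>x. x \<in> X \<Longrightarrow> \<exists>y\<in>Y. y \<in> clust (label_edges l X) x \<and> l y = l x"
    by blast
  \<comment> \<open>The label of a good square is its own interior: a finite set, hence none of the clusters.\<close>
  define l' where "l' v = (if v \<in> X then l v else core L (fst v div L * L, snd v div L * L))" for v
  \<comment> \<open>One root for each closed square: the lower left vertex of its interior, which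
    exists because \<open>L\<close> is at least 2.\<close>
  define S where "S = (\<lambda>(i, j). (i * L + 1, j * L + 1)) ` G"
  have l'_core: "l' v = core L (i * L, j * L)" if "(i, j) \<in> G" "v \<in> core L (i * L, j * L)" for i j v
    using that L by (cases v) (auto simp: l'_def inX core_div_mod)
  have inf: "infinite (l' v)" if "v \<in> X" for v
    using that lr[OF that] l by (auto simp: l'_def Y_def)
  have fin_core: "finite (core L a)" for a
    by (simp add: core_def)
  have sub: "label_edges l X \<subseteq> label_edges l' (sq m)"
  proof
    fix e assume "e \<in> label_edges l X"
    then obtain u w where e: "e = {u, w}" "z2_adj u w" "u \<in> X" "w \<in> X" "l u = l w"
      by (auto simp: label_edges_def)
    then have "u \<in> sq m" "w \<in> sq m" "l' u = l' w"
      by (auto simp: l'_def X_def)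
    then show "e \<in> label_edges l' (sq m)"
      using e unfolding label_edges_def by blast
  qed
  \<comment> \<open>A vertex of \<open>X\<close> is joined within its label to a vertex of an
    infinite cluster, and from there to the rim. A vertex inside a closed square is joined to the
    root of that square.\<close>
  have reach: "clust (label_edges l' (sq m)) v \<inter> (rim m \<union> S) \<noteq> {}" if v: "v \<in> sq m" for v
  proof (cases "v \<in> X")
    case True
    then obtain y where y: "y \<in> Y" "y \<in> clust (label_edges l X) v"
      using lr by blast
    have "clust (label_edges l' (sq m)) y \<inter> rim m \<noteq> {}"
    proof (rule reach_rim[OF \<omega>])
      fix u assume "u \<in> sq m" "infinite (clust \<omega> u)"
      then have "u \<in> Y"
        by (simp add: Y_def)
      then show "l' u = clust \<omega> u"
        using YX l by (auto simp: l'_def)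
    qed (use y in \<open>auto simp: Y_def\<close>)
    moreover have "y \<in> clust (label_edges l' (sq m)) v"
      using y clust_mono[OF sub] by blast
    ultimately show ?thesis
      using clust_trans by blast
  next
    case False
    then obtain i j where ij: "(i, j) \<in> G" "v \<in> core L (i * L, j * L)"
      using v by (auto simp: X_def)
    have core_sq: "core L (i * L, j * L) \<subseteq> sq m"
      using cell_sq[OF ij(1)] by (force simp: core_def cell_def)
    have core_rect: "core L (i * L, j * L) = {i * L + 1..i * L + L - 1} \<times> {j * L + 1..j * L + L - 1}"
      by (auto simp: core_def)
    have "(i * L + 1, j * L + 1) \<in> clust (label_edges l' (sq m)) (fst v, snd v)"
    proof (rule rectangle_connected)
      show "{i * L + 1..i * L + L - 1} \<times> {j * L + 1..j * L + L - 1} \<subseteq> sq m"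
        using core_sq core_rect by simp
    qed (use ij l'_core[OF ij(1)] core_rect in auto)
    then show ?thesis
      using ij by (auto simp: S_def)
  qed
  define ex where "ex f = max 0 (face_changes l' f - 2)" for f
  let ?C = "\<lambda>(i, j). {i * L..<i * L + L} \<times> {j * L..<j * L + L}"
  have three: "3 \<le> sum ex (?C c)" if "c \<in> G" for c
  proof -
    obtain i j where c: "c = (i, j)" by (cases c)
    have ij: "(i, j) \<in> G"
      using that c by simp
    obtain v1 v2 v3 where vs: "v1 \<in> frame L (i * L, j * L)" "v2 \<in> frame L (i * L, j * L)" "v3 \<in> frame L (i * L, j * L)"
      "infinite (clust \<omega> v1)" "infinite (clust \<omega> v2)" "infinite (clust \<omega> v3)"
      "clust \<omega> v1 \<noteq> clust \<omega> v2" "clust \<omega> v1 \<noteq> clust \<omega> v3" "clust \<omega> v2 \<noteq> clust \<omega> v3"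
    proof -
      have "good L (i * L, j * L) \<omega>"
        using ij by (simp add: G_def)
      then show thesis
        using that unfolding good_def by blast
    qed
    have lv: "l' v = clust \<omega> v" if "v \<in> frame L (i * L, j * L)" "infinite (clust \<omega> v)" for v
    proof -
      have "v \<in> X" "v \<in> Y"
        using that frX[OF ij] by (auto simp: Y_def X_def)
      then show ?thesis
        using l by (simp add: l'_def)
    qed
    have lvs: "l' v1 = clust \<omega> v1" "l' v2 = clust \<omega> v2" "l' v3 = clust \<omega> v3"
      using lv vs by blast+
    have "3 \<le> (\<Sum>f\<in>{i * L..<i * L + L} \<times> {j * L..<j * L + L}. max 0 (face_changes l' f - 2))"
    proof (rule frame_excess[OF L, of _ _ _ _ v1 v2 v3])
      show "l' v = core L (i * L, j * L)" if "v \<in> core L (i * L, j * L)" for v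
        using l'_core ij that by blast
      show "l' v \<noteq> core L (i * L, j * L)" if "v \<in> frame L (i * L, j * L)" for v
      proof
        assume "l' v = core L (i * L, j * L)"
        moreover have "infinite (l' v)"
          using inf frX[OF ij] that by blast
        ultimately show False
          using fin_core by simp
      qed
    qed (simp_all add: vs lvs)
    then show ?thesis
      by (simp add: c ex_def)
  qed
  \<comment> \<open>The lower left corners of the faces of a cell form a half-open block, so
    different cells have no face in common and their excesses add up.\<close>
  have div_eq: "x div L = i" if "x \<in> {i * L..<i * L + L}" for x i
    using that L by (intro int_div_pos_eq[of _ _ _ "x - i * L"]) (auto simp: algebra_simps)
  have "3 * int (card G) = (\<Sum>c\<in>G. 3)"
    by simp
  also have "\<dots> \<le> (\<Sum>c\<in>G. sum ex (?C c))"
    by (intro sum_mono three)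
  also have "\<dots> = sum ex (\<Union>c\<in>G. ?C c)"
  proof (rule sum.UNION_disjoint[symmetric])
    show "\<forall>c\<in>G. \<forall>d\<in>G. c \<noteq> d \<longrightarrow> ?C c \<inter> ?C d = {}"
    proof (intro ballI impI)
      fix c d :: vtx assume "c \<noteq> d"
      have "c = d" if "f \<in> ?C c" "f \<in> ?C d" for f :: vtx
      proof -
        have "fst f div L = fst c" "snd f div L = snd c" "fst f div L = fst d" "snd f div L = snd d"
          using that by (auto simp: split_def mem_Times_iff intro!: div_eq)
        then show ?thesis by (simp add: prod_eq_iff)
      qed
      then show "?C c \<inter> ?C d = {}"
        using \<open>c \<noteq> d\<close> by blast
    qed
  qed (use fin in auto)
  also have "\<dots> \<le> sum ex ({0..<m} \<times> {0..<m})"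
  proof (rule sum_mono2)
    have "?C c \<subseteq> {0..<m} \<times> {0..<m}" if "c \<in> G" for c
    proof -
      obtain i j where c: "c = (i, j)" by (cases c)
      have "(i * L, j * L) \<in> sq m" "(i * L + L, j * L + L) \<in> sq m"
        using cell_sq[of i j] that c L by (auto simp: cell_def)
      then show ?thesis
        by (auto simp: c sq_def)
    qed
    then show "(\<Union>c\<in>G. ?C c) \<subseteq> {0..<m} \<times> {0..<m}"
      by blast
  qed (auto simp: ex_def)
  also have "\<dots> \<le> 2 * int (card (rim m \<union> S))"
    unfolding ex_def
    by (rule excess_sum_le[OF m0 _ reach]) (use fin in \<open>auto simp: rim_def S_def\<close>)
  finally have "3 * int (card G) \<le> 2 * int (card (rim m \<union> S))" .
  moreover have "card (rim m \<union> S) \<le> card (rim m) + card G"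
    using card_Un_le[of "rim m" S] card_image_le[OF fin(1)] unfolding S_def by (meson add_left_mono order_trans)
  ultimately show ?thesis
    using card_rim[OF m0] unfolding G_def[symmetric] m_def[symmetric] by linarith
qed

section \<open>Producing a closed square by deleting finitely many edges\<close>

definition three_infinite :: "edge set \<Rightarrow> bool" where
  "three_infinite \<omega> \<longleftrightarrow> (\<exists>v1 v2 v3.
     infinite (clust \<omega> v1) \<and> infinite (clust \<omega> v2) \<and> infinite (clust \<omega> v3) \<and>
     clust \<omega> v1 \<noteq> clust \<omega> v2 \<and> clust \<omega> v1 \<noteq> clust \<omega> v3 \<and> clust \<omega> v2 \<noteq> clust \<omega> v3)"

definition touching :: "vtx set \<Rightarrow> edge set" where
  "touching V = {e \<in> Z2E. e \<inter> V \<noteq> {}}"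

text \<open>After the deletion the old cluster is covered by the core and by the new clusters of
  finitely many frame vertices; since it is infinite, one of these clusters is infinite.\<close>

lemma frame_reached:
  assumes \<omega>: "\<omega> \<subseteq> Z2E" and v: "v \<in> cell L a" "infinite (clust \<omega> v)"
  shows "\<exists>f\<in>frame L a. f \<in> clust \<omega> v \<and> infinite (clust (\<omega> - touching (core L a)) f)"
proof -
  let ?\<omega> = "\<omega> - touching (core L a)"
  have cover: "w \<in> core L a \<or> (\<exists>f\<in>frame L a. f \<in> clust \<omega> v \<and> w \<in> clust ?\<omega> f)" if "w \<in> clust \<omega> v" for w
    using that
  proof (induction rule: clust_induct)
    case refl
    have "v \<in> core L a \<or> v \<in> frame L a"
      using v by (simp add: frame_def)
    then show ?case
      using clust_refl by blast
  next
    case (step x y)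
    have e: "{x, y} \<in> Z2E"
      using step \<omega> by auto
    then have adj: "z2_adj x y"
      by (auto simp: Z2E_def doubleton_eq_iff z2_adj_def)
    show ?case
    proof (cases "x \<in> core L a \<or> y \<in> core L a")
      case True
      then have "y \<in> cell L a"
        using adj by (cases x; cases y) (auto simp: core_def cell_def z2_adj_def)
      then show ?thesis
        using clust_step[OF step.hyps(1,2)] clust_refl unfolding frame_def by blast
    next
      case False
      then have "{x, y} \<in> ?\<omega>"
        using step e by (auto simp: touching_def)
      then show ?thesis
        using step False clust_step by blast
    qed
  qed
  have "finite (core L a)" "finite (frame L a)"
    by (auto simp: core_def frame_def cell_def)
  moreover have "clust \<omega> v \<subseteq> core L a \<union> (\<Union>f\<in>frame L a \<inter> clust \<omega> v. clust ?\<omega> f)"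
    using cover by blast
  ultimately show ?thesis
    using v(2) by (metis (no_types, lifting) IntD1 IntD2 finite_Int finite_UN_I finite_UnI finite_subset)
qed

lemma three_infinite_imp_good:
  assumes \<omega>: "\<omega> \<subseteq> Z2E" and "three_infinite \<omega>"
  shows "\<exists>L\<ge>2. \<exists>a. good L a (\<omega> - touching (core L a))"
proof -
  obtain v1 v2 v3 where v: "infinite (clust \<omega> v1)" "infinite (clust \<omega> v2)" "infinite (clust \<omega> v3)"
     "clust \<omega> v1 \<noteq> clust \<omega> v2" "clust \<omega> v1 \<noteq> clust \<omega> v3" "clust \<omega> v2 \<noteq> clust \<omega> v3"
    using assms(2) unfolding three_infinite_def by blast
  \<comment> \<open>\<open>M\<close> bounds every coordinate, so the cell [-M, M]^2 contains the
    three vertices; the summand 1 ensures that \<open>L\<close> is at least 2.\<close>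
  define M where "M = 1 + \<bar>fst v1\<bar> + \<bar>fst v2\<bar> + \<bar>fst v3\<bar> + \<bar>snd v1\<bar> + \<bar>snd v2\<bar> + \<bar>snd v3\<bar>"
  define L where "L = 2 * M"
  define a where "a = (- M, - M)"
  have "2 \<le> L"
    by (simp add: L_def M_def)
  have "v1 \<in> cell L a" "v2 \<in> cell L a" "v3 \<in> cell L a"
    by (auto simp: cell_def L_def a_def M_def mem_Times_iff)
  then obtain f1 f2 f3 where f: "f1 \<in> frame L a" "f1 \<in> clust \<omega> v1" "infinite (clust (\<omega> - touching (core L a)) f1)"
      "f2 \<in> frame L a" "f2 \<in> clust \<omega> v2" "infinite (clust (\<omega> - touching (core L a)) f2)"
      "f3 \<in> frame L a" "f3 \<in> clust \<omega> v3" "infinite (clust (\<omega> - touching (core L a)) f3)"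
    using frame_reached[OF \<omega>] v by meson
  \<comment> \<open>Deletion can split clusters but never merge them.\<close>
  have ne: "clust (\<omega> - touching (core L a)) f \<noteq> clust (\<omega> - touching (core L a)) g"
    if "f \<in> clust \<omega> v" "g \<in> clust \<omega> w" "clust \<omega> v \<noteq> clust \<omega> w" for f g v w
  proof
    assume "clust (\<omega> - touching (core L a)) f = clust (\<omega> - touching (core L a)) g"
    then have "g \<in> clust \<omega> f"
      using clust_refl[of g] clust_mono[of "\<omega> - touching (core L a)" \<omega> f] by auto
    then show False
      using that clust_eq by metis
  qed
  have "good L a (\<omega> - touching (core L a))"
    unfolding good_def
    using f ne[OF f(2) f(5) v(4)] ne[OF f(2) f(8) v(5)] ne[OF f(5) f(8) v(6)] \<omega>
    by (intro conjI ballI bexI[of _ f1] bexI[of _ f2] bexI[of _ f3]) (auto simp: touching_def)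
  then show ?thesis
    using \<open>2 \<le> L\<close> by blast
qed

lemma finite_touching_core: "finite (touching (core L a))"
proof -
  have "touching (core L a) \<subseteq> (\<lambda>p. {fst p, snd p}) ` (cell L a \<times> cell L a)"
  proof
    fix e assume "e \<in> touching (core L a)"
    then obtain u v where e: "e = {u, v}" "z2_adj u v" "u \<in> core L a \<or> v \<in> core L a"
      by (auto simp: touching_def Z2E_def)
    have near: "y \<in> cell L a" if "z2_adj x y" "x \<in> core L a" for x y
      using that by (cases x; cases y) (auto simp: core_def cell_def z2_adj_def)
    have "z2_adj v u"
      using e(2) by (auto simp: z2_adj_def)
    moreover have "core L a \<subseteq> cell L a"
      by (auto simp: core_def cell_def)
    ultimately have "u \<in> cell L a" "v \<in> cell L a"
      using e(2,3) near by blast+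
    then have "(u, v) \<in> cell L a \<times> cell L a"
      by (rule SigmaI)
    then show "e \<in> (\<lambda>p. {fst p, snd p}) ` (cell L a \<times> cell L a)"
      by (rule rev_image_eqI) (simp only: e(1) fst_conv snd_conv)
  qed
  moreover have "finite (cell L a)"
    by (simp add: cell_def)
  ultimately show ?thesis
    by (meson finite_SigmaI finite_imageI finite_subset)
qed

section \<open>Measurability and translations\<close>

lemma countable_Z2E: "countable Z2E"
proof -
  have "Z2E \<subseteq> (\<lambda>(u, v). {u, v}) ` (UNIV :: (vtx \<times> vtx) set)"
    by (auto simp: Z2E_def)
  then show ?thesis
    by (rule countable_subset) simp
qed

lemma space_z2_cfg [simp]: "space z2_cfg = Pow Z2E"
  by (simp add: z2_cfg_def space_measure_of_conv)

lemma pred_edge [measurable]: "Measurable.pred z2_cfg (\<lambda>\<omega>. e \<in> \<omega>)"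
proof (cases "e \<in> Z2E")
  case True
  then have "{\<omega> \<in> Pow Z2E. e \<in> \<omega>} \<in> sets z2_cfg"
    unfolding z2_cfg_def by (subst sets_measure_of) (auto intro!: sigma_sets.Basic)
  then show ?thesis
    by (simp add: pred_def)
next
  case False
  then have "{\<omega> \<in> Pow Z2E. e \<in> \<omega>} = {}"
    by auto
  then have "{\<omega> \<in> Pow Z2E. e \<in> \<omega>} \<in> sets z2_cfg"
    by (metis sets.empty_sets)
  then show ?thesis
    by (simp add: pred_def)
qed

lemma measurable_z2_cfgI:
  assumes "\<And>x. x \<in> space M \<Longrightarrow> f x \<subseteq> Z2E"
    and "\<And>e. e \<in> Z2E \<Longrightarrow> Measurable.pred M (\<lambda>x. e \<in> f x)"
  shows "f \<in> measurable M z2_cfg"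
  unfolding z2_cfg_def
proof (rule measurable_measure_of)
  fix A assume "A \<in> {{\<omega> \<in> Pow Z2E. e \<in> \<omega>} |e. e \<in> Z2E}"
  then obtain e where e: "e \<in> Z2E" "A = {\<omega> \<in> Pow Z2E. e \<in> \<omega>}"
    by auto
  have "f -` A \<inter> space M = {x \<in> space M. e \<in> f x}"
    using assms(1) e by auto
  then show "f -` A \<inter> space M \<in> sets M"
    using assms(2)[OF e(1)] by (simp add: pred_def)
qed (use assms in auto)

lemma clust_finite_subgraph:
  assumes "w \<in> clust \<omega> v"
  shows "\<exists>F\<subseteq>\<omega>. finite F \<and> w \<in> clust F v"
  using assms
proof (induction rule: clust_induct)
  case refl
  then show ?case
    by (intro exI[of _ "{}"]) (auto intro: clust_refl)
next
  case (step x y)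
  then obtain F where F: "F \<subseteq> \<omega>" "finite F" "x \<in> clust F v"
    by blast
  then have "x \<in> clust (insert {x, y} F) v"
    using clust_mono[of F "insert {x, y} F"] by blast
  then have "y \<in> clust (insert {x, y} F) v"
    by (rule clust_step) simp
  then show ?case
    using F step.hyps by (intro exI[of _ "insert {x, y} F"]) auto
qed

text \<open>A connection uses finitely many edges, so the event is a countable union, over finite
  edge sets, of events that all edges of the set are open.\<close>

lemma pred_clust [measurable]: "Measurable.pred z2_cfg (\<lambda>\<omega>. w \<in> clust \<omega> v)"
proof -
  let ?S = "{F. finite F \<and> F \<subseteq> Z2E \<and> w \<in> clust F v}"
  have c: "countable ?S"
    by (rule countable_subset[OF _ countable_Collect_finite_subset[OF countable_Z2E]]) auto
  have eq: "(w \<in> clust \<omega> v) = (\<exists>F\<in>?S. \<forall>e\<in>F. e \<in> \<omega>)" if "\<omega> \<in> space z2_cfg" for \<omega>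
  proof
    assume "w \<in> clust \<omega> v"
    then obtain F where "F \<subseteq> \<omega>" "finite F" "w \<in> clust F v"
      using clust_finite_subgraph by blast
    then show "\<exists>F\<in>?S. \<forall>e\<in>F. e \<in> \<omega>"
      using that by (intro bexI[of _ F]) auto
  next
    assume "\<exists>F\<in>?S. \<forall>e\<in>F. e \<in> \<omega>"
    then obtain F where "F \<subseteq> \<omega>" "w \<in> clust F v"
      by blast
    then show "w \<in> clust \<omega> v"
      using clust_mono by blast
  qed
  have "{\<omega> \<in> space z2_cfg. \<exists>F\<in>?S. \<forall>e\<in>F. e \<in> \<omega>} \<in> sets z2_cfg"
  proof (rule sets.sets_Collect_countable_Ex'[OF _ c])
    fix F assume "F \<in> ?S"
    then have "Measurable.pred z2_cfg (\<lambda>\<omega>. \<forall>e\<in>F. e \<in> \<omega>)"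
      by (intro pred_intros_finite(3) pred_edge) blast
    then show "{\<omega> \<in> space z2_cfg. \<forall>e\<in>F. e \<in> \<omega>} \<in> sets z2_cfg"
      by (simp add: pred_def)
  qed
  also have "{\<omega> \<in> space z2_cfg. \<exists>F\<in>?S. \<forall>e\<in>F. e \<in> \<omega>} = {\<omega> \<in> space z2_cfg. w \<in> clust \<omega> v}"
    using eq by blast
  finally show ?thesis
    by (simp only: pred_def)
qed

text \<open>Infinity is expressed by quantifiers over lists and vertices, both countable types, so
  that it reduces to countable operations on connection events.\<close>

lemma pred_infinite_clust [measurable]: "Measurable.pred z2_cfg (\<lambda>\<omega>. infinite (clust \<omega> v))"
proof -
  have "infinite S \<longleftrightarrow> (\<forall>xs. \<exists>w. w \<notin> set xs \<and> w \<in> S)" for S :: "vtx set"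
  proof
    assume "infinite S"
    then show "\<forall>xs. \<exists>w. w \<notin> set xs \<and> w \<in> S"
      by (meson List.finite_set finite_subset subsetI)
  next
    assume *: "\<forall>xs. \<exists>w. w \<notin> set xs \<and> w \<in> S"
    show "infinite S"
    proof
      assume "finite S"
      then obtain xs where "set xs = S"
        using finite_list by blast
      then show False
        using * by blast
    qed
  qed
  then show ?thesis
    by simp
qed

lemma pred_clust_eq [measurable]: "Measurable.pred z2_cfg (\<lambda>\<omega>. clust \<omega> v = clust \<omega> w)"
proof -
  have "clust \<omega> v = clust \<omega> w \<longleftrightarrow> w \<in> clust \<omega> v" for \<omega>
    using clust_eq clust_refl by blast
  then show ?thesis
    by simp
qed

lemma pred_has_inf_comp [measurable]: "Measurable.pred z2_cfg has_inf_comp"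
  unfolding has_inf_comp_def[abs_def] by measurable

lemma pred_good [measurable]: "Measurable.pred z2_cfg (good L a)"
proof -
  \<comment> \<open>The range of the quantifier must not depend on \<omega>; the finite set of edges
    touching the core replaces it.\<close>
  have eq: "(\<forall>e\<in>\<omega>. e \<inter> core L a = {}) \<longleftrightarrow> (\<forall>e\<in>touching (core L a). e \<notin> \<omega>)" if "\<omega> \<in> space z2_cfg" for \<omega>
    using that by (auto simp: touching_def)
  have "Measurable.pred z2_cfg (\<lambda>\<omega>. \<forall>e\<in>touching (core L a). e \<notin> \<omega>)"
    by (intro pred_intros_finite(3) finite_touching_core pred_intros_logic pred_edge)
  moreover have "{\<omega> \<in> space z2_cfg. \<forall>e\<in>touching (core L a). e \<notin> \<omega>} =
      {\<omega> \<in> space z2_cfg. \<forall>e\<in>\<omega>. e \<inter> core L a = {}}"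
    using eq by blast
  ultimately have "Measurable.pred z2_cfg (\<lambda>\<omega>. \<forall>e\<in>\<omega>. e \<inter> core L a = {})"
    by (simp only: pred_def)
  then show ?thesis
    unfolding good_def[abs_def]
    by (intro pred_intros_logic pred_intros_countable_bounded pred_infinite_clust pred_clust_eq)
qed

lemma act_translate_mem:
  "e \<in> act ((+) a) \<omega> \<longleftrightarrow> (+) (- a) ` e \<in> \<omega>" for a :: vtx
proof -
  have 1: "(+) a ` (+) (- a) ` e = e" "(+) (- a) ` (+) a ` e = e" for e :: edge
    by (simp_all add: image_image)
  show ?thesis
  proof
    assume "e \<in> act ((+) a) \<omega>"
    then obtain e' where "e' \<in> \<omega>" "e = (+) a ` e'"
      unfolding act_def by blast
    then show "(+) (- a) ` e \<in> \<omega>"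
      using 1 by simp
  next
    assume "(+) (- a) ` e \<in> \<omega>"
    then show "e \<in> act ((+) a) \<omega>"
      unfolding act_def using 1(1)[of e, symmetric] by (rule rev_image_eqI)
  qed
qed

lemma z2_adj_translate [simp]: "z2_adj (a + u) (a + v) = z2_adj u v"
  by (simp add: z2_adj_def)

lemma Z2E_translate: "(+) a ` e \<in> Z2E \<longleftrightarrow> e \<in> Z2E" for a :: vtx
proof -
  have *: "(+) a ` e \<in> Z2E" if "e \<in> Z2E" for a :: vtx and e
  proof -
    obtain u v where "e = {u, v}" "z2_adj u v"
      using \<open>e \<in> Z2E\<close> by (auto simp: Z2E_def)
    then have "(+) a ` e = {a + u, a + v}" "z2_adj (a + u) (a + v)"
      by auto
    then show ?thesis
      unfolding Z2E_def by blast
  qed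
  have "(+) (- a) ` (+) a ` e = e"
    by (auto simp: image_image)
  then show ?thesis
    using * by metis
qed

lemma z2_aut_translate: "z2_aut ((+) a)" for a :: vtx
  by (simp add: z2_aut_def)

lemma measurable_act_translate: "act ((+) a) \<in> measurable z2_cfg z2_cfg" for a :: vtx
proof (rule measurable_z2_cfgI)
  show "act ((+) a) \<omega> \<subseteq> Z2E" if "\<omega> \<in> space z2_cfg" for \<omega>
    using that by (auto simp: act_def Z2E_translate)
  show "Measurable.pred z2_cfg (\<lambda>\<omega>. e \<in> act ((+) a) \<omega>)" for e
    unfolding act_translate_mem by measurable
qed

lemma clust_translate: "clust (act ((+) a) \<omega>) (a + v) = (+) a ` clust \<omega> v" for a :: vtx
proof -
  have *: "a + w \<in> clust (act ((+) a) \<omega>) (a + v)" if "w \<in> clust \<omega> v" for a v w :: vtx and \<omega>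
    using that
  proof (induction rule: clust_induct)
    case (step x y)
    have "{a + x, a + y} \<in> act ((+) a) \<omega>"
      using step by (auto simp: act_translate_mem)
    then show ?case
      using step clust_step by blast
  qed (rule clust_refl)
  have inv: "act ((+) (- a)) (act ((+) a) \<omega>) = \<omega>"
    by (auto simp: act_translate_mem set_eq_iff image_image)
  have "w \<in> (+) a ` clust \<omega> v" if "w \<in> clust (act ((+) a) \<omega>) (a + v)" for w
    using *[OF that, of "- a"] by (intro image_eqI[of _ _ "- a + w"]) (simp_all add: inv)
  then show ?thesis
    using * by blast
qed

lemma good_translate: "good L (a + b) (act ((+) a) \<omega>) \<longleftrightarrow> good L b \<omega>" for a :: vtx
proof -
  have *: "good L (a + b) (act ((+) a) \<omega>)" if g: "good L b \<omega>" for a b and \<omega>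
  proof -
    have c: "v \<in> core L b \<longleftrightarrow> a + v \<in> core L (a + b)" "v \<in> frame L b \<longleftrightarrow> a + v \<in> frame L (a + b)" for v
      by (auto simp: core_def frame_def cell_def mem_Times_iff)
    have "e \<inter> core L (a + b) = {}" if e: "e \<in> act ((+) a) \<omega>" for e
    proof -
      obtain e' where "e' \<in> \<omega>" "e = (+) a ` e'"
        using e unfolding act_def by blast
      moreover have "e' \<inter> core L b = {}" if "e' \<in> \<omega>" for e'
        using \<open>good L b \<omega>\<close> that unfolding good_def by blast
      ultimately show ?thesis
        using c(1) by blast
    qed
    then have core: "\<forall>e\<in>act ((+) a) \<omega>. e \<inter> core L (a + b) = {}"
      by blast
    obtain v1 v2 v3 where v: "v1 \<in> frame L b" "v2 \<in> frame L b" "v3 \<in> frame L b"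
       "infinite (clust \<omega> v1)" "infinite (clust \<omega> v2)" "infinite (clust \<omega> v3)"
       "clust \<omega> v1 \<noteq> clust \<omega> v2" "clust \<omega> v1 \<noteq> clust \<omega> v3" "clust \<omega> v2 \<noteq> clust \<omega> v3"
      using g unfolding good_def by blast
    have inf: "infinite (clust (act ((+) a) \<omega>) (a + v))" if "infinite (clust \<omega> v)" for v
      using that by (simp add: clust_translate finite_image_iff)
    have ne: "clust (act ((+) a) \<omega>) (a + v) \<noteq> clust (act ((+) a) \<omega>) (a + w)" if "clust \<omega> v \<noteq> clust \<omega> w" for v w
      using that by (simp add: clust_translate inj_image_eq_iff)
    show ?thesis
      unfolding good_def
      using core v(1-3)[unfolded c(2)] v(4-6)[THEN inf] v(7-9)[THEN ne] by blast
  qed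
  have "act ((+) (- a)) (act ((+) a) \<omega>) = \<omega>"
    by (auto simp: act_translate_mem set_eq_iff image_image)
  then show ?thesis
    using *[of b \<omega> a] *[of "a + b" "act ((+) a) \<omega>" "- a"] by (auto simp: add.assoc[symmetric])
qed

section \<open>Thinning\<close>

lemma indep_vars_PiM_coordinates:
  assumes M: "\<And>i. prob_space (M i)" and I: "I \<noteq> {}"
  shows "prob_space.indep_vars (PiM I M) M (\<lambda>i x. x i) I"
proof -
  interpret prob_space "PiM I M"
    by (rule prob_space_PiM) (rule M)
  have "distr (PiM I M) (PiM I M) (\<lambda>x. \<lambda>i\<in>I. x i) = distr (PiM I M) (PiM I M) (\<lambda>x. x)"
    by (rule distr_cong) (auto simp: space_PiM PiE_restrict)
  also have "\<dots> = PiM I M"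
    by (rule distr_id)
  also have "\<dots> = PiM I (\<lambda>i. distr (PiM I M) (M i) (\<lambda>x. x i))"
    by (intro PiM_cong refl) (simp add: distr_PiM_component M)
  finally show ?thesis
    using I by (subst indep_vars_iff_distr_eq_PiM') auto
qed

text \<open>The complements of \<open>A\<close> and \<open>B\<close> depend on disjoint sets of
  coordinates and are therefore independent. If their intersection is null, one of them is null.
  This yields both deletion tolerance and the joint survival of clusters.\<close>

lemma AE_PiM_disj_indep:
  assumes M: "\<And>i. prob_space (M i)" and I: "I \<noteq> {}" "K \<subseteq> I" "J \<subseteq> I" "K \<inter> J = {}"
    and A [measurable]: "Measurable.pred (PiM K M) A" and B [measurable]: "Measurable.pred (PiM J M) B"
    and AB: "AE x in PiM I M. A (restrict x K) \<or> B (restrict x J)"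
  shows "(AE x in PiM I M. A (restrict x K)) \<or> (AE x in PiM I M. B (restrict x J))"
proof -
  interpret prob_space "PiM I M"
    by (rule prob_space_PiM) (rule M)
  have [measurable]: "(\<lambda>x. restrict x K) \<in> measurable (PiM I M) (PiM K M)"
      "(\<lambda>x. restrict x J) \<in> measurable (PiM I M) (PiM J M)"
    using I by (auto intro: measurable_restrict_subset)
  have ind: "indep_var (PiM K M) (\<lambda>x. restrict (\<lambda>i. x i) K) (PiM J M) (\<lambda>x. restrict (\<lambda>i. x i) J)"
    by (rule indep_var_restrict[OF indep_vars_PiM_coordinates[OF M I(1)] I(4,2,3)])
  let ?XA = "{y \<in> space (PiM K M). \<not> A y}" and ?XB = "{y \<in> space (PiM J M). \<not> B y}"
  have space: "restrict x K \<in> space (PiM K M)" "restrict x J \<in> space (PiM J M)" if "x \<in> space (PiM I M)" for x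
    using that I by (auto simp: space_PiM PiE_iff)
  have "prob {x \<in> space (PiM I M). \<not> A (restrict x K) \<and> \<not> B (restrict x J)} =
      prob {x \<in> space (PiM I M). \<not> A (restrict x K)} * prob {x \<in> space (PiM I M). \<not> B (restrict x J)}"
  proof -
    have "prob ((\<lambda>x. (restrict (\<lambda>i. x i) K, restrict (\<lambda>i. x i) J)) -` (?XA \<times> ?XB) \<inter> space (PiM I M)) =
        prob ((\<lambda>x. restrict (\<lambda>i. x i) K) -` ?XA \<inter> space (PiM I M)) *
        prob ((\<lambda>x. restrict (\<lambda>i. x i) J) -` ?XB \<inter> space (PiM I M))"
      by (rule indep_varD[OF ind]) measurable
    moreover have "(\<lambda>x. (restrict (\<lambda>i. x i) K, restrict (\<lambda>i. x i) J)) -` (?XA \<times> ?XB) \<inter> space (PiM I M) =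
        {x \<in> space (PiM I M). \<not> A (restrict x K) \<and> \<not> B (restrict x J)}"
      "(\<lambda>x. restrict (\<lambda>i. x i) K) -` ?XA \<inter> space (PiM I M) = {x \<in> space (PiM I M). \<not> A (restrict x K)}"
      "(\<lambda>x. restrict (\<lambda>i. x i) J) -` ?XB \<inter> space (PiM I M) = {x \<in> space (PiM I M). \<not> B (restrict x J)}"
      using space by auto
    ultimately show ?thesis
      by simp
  qed
  moreover have "prob {x \<in> space (PiM I M). \<not> A (restrict x K) \<and> \<not> B (restrict x J)} = 0"
    using AB by (subst prob_Collect_eq_0) auto
  ultimately have "prob {x \<in> space (PiM I M). \<not> A (restrict x K)} = 0 \<or> prob {x \<in> space (PiM I M). \<not> B (restrict x J)} = 0"
    by simp
  then show ?thesis
    by (subst (asm) (1 2) prob_Collect_eq_0) auto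
qed

abbreviation unif :: "real measure" where
  "unif \<equiv> uniform_measure lborel {0..1}"

definition noise :: "edge set \<Rightarrow> (edge \<Rightarrow> real) measure" where
  "noise K = PiM K (\<lambda>_. unif)"

text \<open>One family of labels couples the thinnings for all \<open>p\<close>, increasing in
  \<open>p\<close>.\<close>

definition thin :: "real \<Rightarrow> edge set \<Rightarrow> (edge \<Rightarrow> real) \<Rightarrow> edge set" where
  "thin p \<omega> u = {e \<in> \<omega>. u e \<le> p}"

lemma prob_space_unif: "prob_space unif"
  by (rule prob_space_uniform_measure) auto

lemma prob_space_noise: "prob_space (noise K)"
  unfolding noise_def by (intro prob_space_PiM prob_space_unif)

lemma emeasure_unif_le:
  assumes "0 \<le> p" "p \<le> 1"
  shows "emeasure unif {x. x \<le> p} = ennreal p" "emeasure unif {x. \<not> x \<le> p} = ennreal (1 - p)"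
proof -
  have "{0..1} \<inter> {x. x \<le> p} = {0..p}" "{0..1} \<inter> {x. \<not> x \<le> p} = {p<..1}"
    using assms by auto
  then show "emeasure unif {x. x \<le> p} = ennreal p" "emeasure unif {x. \<not> x \<le> p} = ennreal (1 - p)"
    using assms by (simp_all add: emeasure_uniform_measure divide_ennreal_def)
qed

lemma measurable_unif_le: "(\<lambda>x. x \<le> p) \<in> measurable unif (measure_pmf B)" for B :: "bool pmf"
proof -
  have "(\<lambda>x::real. x \<le> p) \<in> measurable borel (count_space UNIV)"
    by measurable
  then show ?thesis
    by (subst measurable_cong_sets[of unif borel _ "count_space UNIV"]) auto
qed

lemma distr_unif_bernoulli:
  assumes "0 \<le> p" "p \<le> 1"
  shows "distr unif (measure_pmf (bernoulli_pmf p)) (\<lambda>x. x \<le> p) = measure_pmf (bernoulli_pmf p)"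
proof (rule measure_eqI_finite[of _ UNIV])
  note measurable_unif_le [measurable]
  fix b :: bool
  have "(\<lambda>x. x \<le> p) -` {b} = (if b then {x. x \<le> p} else {x. \<not> x \<le> p})"
    by auto
  then show "emeasure (distr unif (measure_pmf (bernoulli_pmf p)) (\<lambda>x. x \<le> p)) {b} =
      emeasure (measure_pmf (bernoulli_pmf p)) {b}"
    using assms emeasure_unif_le[OF assms] by (simp add: emeasure_distr emeasure_pmf_single)
qed auto

lemma noise_component [measurable]: "e \<in> K \<Longrightarrow> (\<lambda>u. u e) \<in> borel_measurable (noise K)"
proof -
  assume "e \<in> K"
  then have "(\<lambda>u. u e) \<in> measurable (noise K) unif"
    unfolding noise_def by (rule measurable_component_singleton)
  then show ?thesis
    by (simp add: measurable_cong_sets[OF refl sets_uniform_measure])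
qed

lemma thin_measurable:
  assumes "\<omega> \<subseteq> K" "\<omega> \<subseteq> Z2E"
  shows "thin p \<omega> \<in> measurable (noise K) z2_cfg"
proof (rule measurable_z2_cfgI)
  show "thin p \<omega> u \<subseteq> Z2E" for u
    using assms by (auto simp: thin_def)
  show "Measurable.pred (noise K) (\<lambda>u. e \<in> thin p \<omega> u)" for e
  proof (cases "e \<in> \<omega>")
    case True
    then have [measurable]: "(\<lambda>u. u e) \<in> borel_measurable (noise K)"
      using assms by (intro noise_component) auto
    show ?thesis
      using True by (simp add: thin_def)
  qed (simp add: thin_def)
qed

text \<open>Robustness is stated with a coin for each edge of one cluster, while the thinning uses
  labels on the whole lattice. Thresholding the labels on \<open>E\<close> reproduces the
  coins.\<close>

lemma AE_bern_of_noise: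
  assumes E: "E \<subseteq> Z2E" "E \<noteq> {}" and q: "0 \<le> q" "q \<le> 1"
    and X [measurable]: "Measurable.pred z2_cfg X" and ae: "AE u in noise Z2E. X (thin q E u)"
  shows "AE \<eta> in bern E q. X {e \<in> E. \<eta> e}"
proof -
  let ?B = "\<lambda>_::edge. measure_pmf (bernoulli_pmf q)"
  interpret prob_space "noise Z2E"
    by (rule prob_space_noise)
  note c = measurable_unif_le[of q "bernoulli_pmf q"]
  have "Z2E \<noteq> {}"
    using E by blast
  then have "indep_vars (\<lambda>_. unif) (\<lambda>e u. u e) Z2E"
    unfolding noise_def by (intro indep_vars_PiM_coordinates prob_space_unif)
  then have "indep_vars (\<lambda>_. unif) (\<lambda>e u. u e) E"
    using E(1) by (rule indep_vars_subset)
  then have "indep_vars ?B (\<lambda>e u. u e \<le> q) E"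
    by (rule indep_vars_compose2) (rule c)
  moreover have rv: "(\<lambda>u. u e \<le> q) \<in> measurable (noise Z2E) (?B e)" if "e \<in> E" for e
  proof -
    have "(\<lambda>u. u e) \<in> measurable (noise Z2E) unif"
      using that E unfolding noise_def by (intro measurable_component_singleton) blast
    then show ?thesis
      by (rule measurable_compose[OF _ c])
  qed
  ultimately have "distr (noise Z2E) (PiM E ?B) (\<lambda>u. \<lambda>e\<in>E. u e \<le> q) =
      PiM E (\<lambda>e. distr (noise Z2E) (?B e) (\<lambda>u. u e \<le> q))"
    using E(2) by (subst (asm) indep_vars_iff_distr_eq_PiM') auto
  also have "\<dots> = bern E q"
    unfolding bern_def
  proof (intro PiM_cong refl)
    fix e assume e: "e \<in> E"
    have "distr (noise Z2E) (?B e) (\<lambda>u. u e \<le> q) = distr (distr (noise Z2E) unif (\<lambda>u. u e)) (?B e) (\<lambda>x. x \<le> q)"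
      using e E unfolding noise_def by (subst distr_distr) (auto simp: comp_def)
    also have "distr (noise Z2E) unif (\<lambda>u. u e) = unif"
      using e E unfolding noise_def by (intro distr_PiM_component prob_space_unif) auto
    finally show "distr (noise Z2E) (?B e) (\<lambda>u. u e \<le> q) = ?B e"
      using q by (simp add: distr_unif_bernoulli)
  qed
  finally have law: "bern E q = distr (noise Z2E) (PiM E ?B) (\<lambda>u. \<lambda>e\<in>E. u e \<le> q)" ..
  have m1: "(\<lambda>\<eta>. {e \<in> E. \<eta> e}) \<in> measurable (PiM E ?B) z2_cfg"
  proof (rule measurable_z2_cfgI)
    show "Measurable.pred (PiM E ?B) (\<lambda>\<eta>. e \<in> {e \<in> E. \<eta> e})" for e
    proof (cases "e \<in> E")
      case True
      then have "(\<lambda>\<eta>. \<eta> e) \<in> measurable (PiM E ?B) (?B e)"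
        by (rule measurable_component_singleton)
      then show ?thesis
        using True by (simp add: measurable_cong_sets[OF refl sets_measure_pmf_count_space])
    qed simp
  qed (use E in auto)
  have m2: "(\<lambda>u. \<lambda>e\<in>E. u e \<le> q) \<in> measurable (noise Z2E) (PiM E ?B)"
    by (intro measurable_restrict rv)
  have "{e \<in> E. (\<lambda>e\<in>E. u e \<le> q) e} = thin q E u" for u
    by (auto simp: thin_def)
  then show ?thesis
    unfolding law using ae measurable_compose[OF m1 X]
    by (subst AE_distr_iff[OF m2]) (simp_all add: pred_def)
qed

section \<open>Closed squares have density zero in a translation invariant process\<close>

text \<open>By invariance every cell is good with the same probability g. An n by n array of cells
  has n^2 g good cells on average, but never more than a multiple of n.\<close>

lemma good_null:
  assumes "prob_space Q" and sets: "sets Q = sets z2_cfg"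
    and inv: "\<And>a. distr Q Q (act ((+) a)) = Q" and L: "2 \<le> L"
  shows "AE \<omega> in Q. \<not> good L a \<omega>"
proof -
  interpret prob_space Q by fact
  have space: "space Q = Pow Z2E"
    using sets_eq_imp_space_eq[OF sets] by simp
  have meas: "{\<omega> \<in> space Q. good L b \<omega>} \<in> events" for b
    using pred_good[of L b] by (simp add: sets space pred_def)
  have act: "act ((+) b) \<in> measurable Q Q" for b
    using measurable_act_translate[of b] measurable_cong_sets[OF sets sets] by blast
  define g where "g = prob {\<omega> \<in> space Q. good L (0, 0) \<omega>}"
  have g: "prob {\<omega> \<in> space Q. good L b \<omega>} = g" for b
  proof -
    have "prob {\<omega> \<in> space Q. good L b \<omega>} = measure (distr Q Q (act ((+) b))) {\<omega> \<in> space Q. good L b \<omega>}"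
      by (simp add: inv)
    also have "\<dots> = prob (act ((+) b) -` {\<omega> \<in> space Q. good L b \<omega>} \<inter> space Q)"
      by (rule measure_distr[OF act meas])
    also have "act ((+) b) -` {\<omega> \<in> space Q. good L b \<omega>} \<inter> space Q = {\<omega> \<in> space Q. good L (0, 0) \<omega>}"
      using measurable_space[OF act[of b]] good_translate[of L b "(0, 0)"] by (auto simp: zero_prod_def[symmetric])
    finally show ?thesis
      by (simp add: g_def)
  qed
  have bound: "real n * real n * g \<le> 8 * (real n * of_int L + 1)" for n :: nat
  proof -
    let ?C = "{0..<int n} \<times> {0..<int n}" and ?A = "\<lambda>c. {\<omega> \<in> space Q. good L (fst c * L, snd c * L) \<omega>}"
    have "real n * real n * g = (\<Sum>c\<in>?C. prob (?A c))"
      by (simp add: g)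
    also have "\<dots> = (\<Sum>c\<in>?C. expectation (indicator (?A c)))"
      by (simp add: Int_absorb2 meas)
    also have "\<dots> = expectation (\<lambda>\<omega>. \<Sum>c\<in>?C. indicator (?A c) \<omega>)"
      by (intro Bochner_Integration.integral_sum[symmetric] integrable_real_indicator meas) (simp add: emeasure_eq_measure)
    also have "\<dots> \<le> 8 * (real n * of_int L + 1)"
    proof (rule integral_le_const)
      show "integrable Q (\<lambda>\<omega>. \<Sum>c\<in>?C. indicator (?A c) \<omega> :: real)"
        by (intro Bochner_Integration.integrable_sum integrable_real_indicator meas) (simp add: emeasure_eq_measure)
      have "(\<Sum>c\<in>?C. indicator (?A c) \<omega> :: real) \<le> 8 * (real n * of_int L + 1)" if "\<omega> \<in> space Q" for \<omega>
      proof -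
        have "(\<Sum>c\<in>?C. indicator (?A c) \<omega> :: real) = (\<Sum>c\<in>?C. of_bool (good L (fst c * L, snd c * L) \<omega>))"
          using that by (intro sum.cong refl) (simp add: indicator_def)
        also have "\<dots> = real (card (?C \<inter> {c. good L (fst c * L, snd c * L) \<omega>}))"
          by (intro sum_of_bool_eq finite_cartesian_product finite_atLeastLessThan_int)
        also have "?C \<inter> {c. good L (fst c * L, snd c * L) \<omega>} = {(i, j) \<in> ?C. good L (i * L, j * L) \<omega>}"
          by auto
        also have "real (card \<dots>) \<le> real_of_int (8 * (int n * L + 1))"
        proof -
          have "\<omega> \<subseteq> Z2E"
            using that space by simp
          then have "int (card {(i, j) \<in> ?C. good L (i * L, j * L) \<omega>}) \<le> 8 * (int n * L + 1)"
            using L by (intro card_good_cells_le) auto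
          then have "real_of_int (int (card {(i, j) \<in> ?C. good L (i * L, j * L) \<omega>})) \<le> real_of_int (8 * (int n * L + 1))"
            by (rule of_int_le_iff[THEN iffD2])
          then show ?thesis
            by simp
        qed
        finally show ?thesis
          by simp
      qed
      then show "AE \<omega> in Q. (\<Sum>c\<in>?C. indicator (?A c) \<omega> :: real) \<le> 8 * (real n * of_int L + 1)"
        by (rule AE_I2)
    qed
    finally show ?thesis .
  qed
  have "g = 0"
  proof (rule ccontr)
    assume "g \<noteq> 0"
    then have "0 < g"
      by (simp add: g_def zero_less_measure_iff)
    \<comment> \<open>For n >= 1 the bound gives n g <= 8 (L + 1 / n) <= 8 (L + 1), which fails for
      large n when g > 0.\<close>
    then obtain n :: nat where n: "8 * (of_int L + 1) < real n * g"
      using reals_Archimedean3 by blast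
    then have "0 < n"
      using L by (cases "n = 0") auto
    then have "real n * (8 * (of_int L + 1)) < real n * (real n * g)"
      using n by simp
    moreover have "8 * (real n * of_int L + 1) \<le> real n * (8 * (of_int L + 1))"
      using \<open>0 < n\<close> by (simp add: algebra_simps)
    ultimately show False
      using bound[of n] by (simp add: mult.assoc)
  qed
  then show ?thesis
    using g[of a] prob_Collect_eq_0[OF meas] by simp
qed

lemma thin_pair_measurable:
  assumes sets: "sets P = sets z2_cfg"
  shows "(\<lambda>(\<omega>, u). thin p \<omega> u) \<in> measurable (P \<Otimes>\<^sub>M noise Z2E) z2_cfg"
proof (rule measurable_z2_cfgI)
  have space: "space P = Pow Z2E"
    using sets_eq_imp_space_eq[OF sets] by simp
  show "(case x of (\<omega>, u) \<Rightarrow> thin p \<omega> u) \<subseteq> Z2E" if "x \<in> space (P \<Otimes>\<^sub>M noise Z2E)" for x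
    using that by (auto simp: thin_def space_pair_measure space)
  fix e assume e: "e \<in> Z2E"
  have "Measurable.pred P (\<lambda>\<omega>. e \<in> \<omega>)"
    using pred_edge[of e] by (simp add: measurable_cong_sets[OF sets refl])
  then have "Measurable.pred (P \<Otimes>\<^sub>M noise Z2E) (\<lambda>x. e \<in> fst x)"
    by (rule measurable_compose[OF measurable_fst])
  moreover have "(\<lambda>x. snd x e) \<in> borel_measurable (P \<Otimes>\<^sub>M noise Z2E)"
    by (rule measurable_compose[OF measurable_snd noise_component[OF e]])
  then have "Measurable.pred (P \<Otimes>\<^sub>M noise Z2E) (\<lambda>x. snd x e \<le> p)"
    by measurable
  ultimately have "Measurable.pred (P \<Otimes>\<^sub>M noise Z2E) (\<lambda>x. e \<in> fst x \<and> snd x e \<le> p)"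
    by (rule pred_intros_logic)
  then show "Measurable.pred (P \<Otimes>\<^sub>M noise Z2E) (\<lambda>x. e \<in> (case x of (\<omega>, u) \<Rightarrow> thin p \<omega> u))"
    by (simp add: thin_def split_def)
qed

text \<open>Labels travel with the edges under translation. The restriction to \<open>Z2E\<close>
  keeps the result extensional, as elements of the product space are.\<close>

definition shift_noise :: "vtx \<Rightarrow> (edge \<Rightarrow> real) \<Rightarrow> edge \<Rightarrow> real" where
  "shift_noise a u = (\<lambda>e\<in>Z2E. u ((+) (- a) ` e))"

lemma shift_noise_measurable: "shift_noise a \<in> measurable (noise Z2E) (noise Z2E)"
proof -
  have "(\<lambda>u. u ((+) (- a) ` e)) \<in> measurable (noise Z2E) unif" if "e \<in> Z2E" for e
    using that unfolding noise_def by (intro measurable_component_singleton Z2E_translate[THEN iffD2])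
  then show ?thesis
    unfolding shift_noise_def[abs_def] noise_def[of Z2E] by (intro measurable_restrict) (simp add: noise_def)
qed

lemma distr_shift_noise: "distr (noise Z2E) (noise Z2E) (shift_noise a) = noise Z2E"
proof -
  have "inj_on ((`) ((+) (- a))) Z2E"
    by (rule inj_onI) (rule inj_image_eq_iff[THEN iffD1, OF inj_on_add])
  moreover have "(`) ((+) (- a)) \<in> Z2E \<rightarrow> Z2E"
    by (rule funcsetI) (rule Z2E_translate[THEN iffD2])
  ultimately show ?thesis
    unfolding noise_def shift_noise_def[abs_def]
    by (rule distr_PiM_reindex[of Z2E "\<lambda>_. unif", OF prob_space_unif])
qed

lemma thin_shift:
  assumes "\<omega> \<subseteq> Z2E"
  shows "thin p (act ((+) a) \<omega>) (shift_noise a u) = act ((+) a) (thin p \<omega> u)"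
proof (rule set_eqI)
  fix e
  have "(+) (- a) ` e \<in> \<omega> \<Longrightarrow> e \<in> Z2E"
    using assms Z2E_translate by blast
  then show "e \<in> thin p (act ((+) a) \<omega>) (shift_noise a u) \<longleftrightarrow> e \<in> act ((+) a) (thin p \<omega> u)"
    by (auto simp: thin_def act_translate_mem shift_noise_def)
qed

text \<open>Thinning commutes with translating configuration and labels together, and this joint
  translation preserves the product measure.\<close>

lemma thinned_translation_invariant:
  fixes p :: real
  assumes P: "prob_space P" and sets: "sets P = sets z2_cfg"
    and inv: "\<And>a. distr P P (act ((+) a)) = P"
  defines "Q \<equiv> distr (P \<Otimes>\<^sub>M noise Z2E) z2_cfg (\<lambda>(\<omega>, u). thin p \<omega> u)"
  shows "distr Q Q (act ((+) a)) = Q"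
proof -
  let ?M = "P \<Otimes>\<^sub>M noise Z2E" and ?t = "\<lambda>(\<omega>, u). thin p \<omega> u"
  let ?s = "\<lambda>(\<omega>, u). (act ((+) a) \<omega>, shift_noise a u)"
  interpret P: prob_space P by fact
  interpret N: prob_space "noise Z2E" by (rule prob_space_noise)
  have space: "space P = Pow Z2E"
    using sets_eq_imp_space_eq[OF sets] by simp
  have act: "act ((+) a) \<in> measurable P P"
    using measurable_act_translate[of a] measurable_cong_sets[OF sets sets] by blast
  note t = thin_pair_measurable[OF sets, of p]
  have s: "?s \<in> measurable ?M ?M"
    using act shift_noise_measurable[of a] by measurable
  have "distr P P (act ((+) a)) \<Otimes>\<^sub>M distr (noise Z2E) (noise Z2E) (shift_noise a) = distr ?M ?M ?s"
    by (rule pair_measure_distr[OF act shift_noise_measurable])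
       (simp add: distr_shift_noise N.sigma_finite_measure_axioms)
  then have pres: "distr ?M ?M ?s = ?M"
    by (simp add: inv distr_shift_noise)
  have "distr Q Q (act ((+) a)) = distr Q z2_cfg (act ((+) a))"
    by (rule distr_cong) (simp_all add: Q_def)
  also have "\<dots> = distr ?M z2_cfg (act ((+) a) \<circ> ?t)"
    unfolding Q_def by (rule distr_distr[OF measurable_act_translate t])
  also have "\<dots> = distr ?M z2_cfg (?t \<circ> ?s)"
    by (rule distr_cong) (auto simp: space_pair_measure space thin_shift)
  also have "\<dots> = distr (distr ?M ?M ?s) z2_cfg ?t"
    by (rule distr_distr[OF t s, symmetric])
  also have "\<dots> = Q"
    unfolding pres Q_def ..
  finally show ?thesis .
qed

section \<open>Deletion tolerance of the thinned process\<close>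

lemma thin_restrict: "\<omega> \<subseteq> K \<Longrightarrow> thin p \<omega> (restrict u K) = thin p \<omega> u"
  by (auto simp: thin_def)

lemma Z2E_nonempty: "Z2E \<noteq> {}"
proof -
  have "{(0, 0), (1, 0)} \<in> Z2E"
    unfolding Z2E_def z2_adj_def by (intro CollectI exI[of _ "(0, 0)"] exI[of _ "(1, 0)"]) simp
  then show ?thesis
    by blast
qed

text \<open>By independence the probability that all labels on \<open>T\<close> exceed
  \<open>p\<close> is (1 - p)^|T|, which is positive since p < 1.\<close>

lemma noise_above_not_null:
  assumes T: "T \<subseteq> Z2E" "finite T" and p: "0 \<le> p" "p < 1"
  shows "\<not> (AE u in noise Z2E. \<not> (\<forall>e\<in>T. p < u e))"
proof
  assume ae: "AE u in noise Z2E. \<not> (\<forall>e\<in>T. p < u e)"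
  interpret product_prob_space "\<lambda>_::edge. unif" Z2E
    by (intro product_prob_spaceI prob_space_unif)
  have "emeasure (noise Z2E) {u \<in> space (noise Z2E). \<forall>e\<in>T. u e \<in> {x. \<not> x \<le> p}} = (\<Prod>e\<in>T. ennreal (1 - p))"
    unfolding noise_def
    by (subst emeasure_PiM_Collect[OF T]) (simp, simp only: emeasure_unif_le(2)[OF p(1) less_imp_le[OF p(2)]])
  also have "\<dots> \<noteq> 0"
    using p by (simp add: prod_ennreal)
  finally have ne: "emeasure (noise Z2E) {u \<in> space (noise Z2E). \<forall>e\<in>T. p < u e} \<noteq> 0"
    by (simp add: not_le)
  have "Measurable.pred (noise Z2E) (\<lambda>u. p < u e)" if "e \<in> T" for e
    using noise_component[of e Z2E] that T by (intro borel_measurable_const borel_measurable_pred_less) auto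
  then have "Measurable.pred (noise Z2E) (\<lambda>u. \<forall>e\<in>T. p < u e)"
    using T by (intro pred_intros_finite(3))
  then have "emeasure (noise Z2E) {u \<in> space (noise Z2E). \<forall>e\<in>T. p < u e} = 0"
    using ae by (subst (asm) AE_iff_measurable[OF _ refl]) (simp_all add: pred_def)
  then show False
    using ne by simp
qed

text \<open>Deletion tolerance: closing the finitely many edges at \<open>core L a\<close> is independent of the
  rest of the thinning and has positive probability.\<close>

lemma not_good_after_deletion:
  assumes \<omega>: "\<omega> \<subseteq> Z2E" and p: "0 \<le> p" "p < 1"
    and ae: "AE u in noise Z2E. \<not> good L a (thin p \<omega> u)"
  shows "AE u in noise Z2E. \<not> good L a (thin p \<omega> u - touching (core L a))"
proof -
  let ?T = "touching (core L a)"
  let ?K = "Z2E - ?T"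
  have T: "?T \<subseteq> Z2E"
    by (auto simp: touching_def)
  \<comment> \<open>The thinning with the core edges deleted is a function of the labels off
    \<open>?T\<close> alone.\<close>
  have diff: "thin p (\<omega> - ?T) (restrict u ?K) = thin p \<omega> u - ?T" for u
    using \<omega> by (auto simp: thin_def)
  have disj: "(AE u in PiM Z2E (\<lambda>_. unif). \<not> good L a (thin p (\<omega> - ?T) (restrict u ?K))) \<or>
      (AE u in PiM Z2E (\<lambda>_. unif). \<not> (\<forall>e\<in>?T. p < restrict u ?T e))"
  proof (rule AE_PiM_disj_indep)
    have "thin p (\<omega> - ?T) \<in> measurable (noise ?K) z2_cfg"
      by (rule thin_measurable) (use \<omega> in auto)
    then show "Measurable.pred (PiM ?K (\<lambda>_. unif)) (\<lambda>u. \<not> good L a (thin p (\<omega> - ?T) u))"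
      unfolding noise_def by measurable
    have "Measurable.pred (noise ?T) (\<lambda>u. p < u e)" if "e \<in> ?T" for e
      using noise_component[OF that] by measurable
    then have "Measurable.pred (noise ?T) (\<lambda>u. \<forall>e\<in>?T. p < u e)"
      by (intro pred_intros_finite(3) finite_touching_core)
    then show "Measurable.pred (PiM ?T (\<lambda>_. unif)) (\<lambda>u. \<not> (\<forall>e\<in>?T. p < u e))"
      unfolding noise_def by measurable
    show "AE u in PiM Z2E (\<lambda>_. unif). \<not> good L a (thin p (\<omega> - ?T) (restrict u ?K)) \<or>
        \<not> (\<forall>e\<in>?T. p < restrict u ?T e)"
      using ae unfolding noise_def
    proof eventually_elim
      case (elim u)
      show ?case
      proof (cases "\<forall>e\<in>?T. p < u e")
        case True
        \<comment> \<open>When all labels on \<open>?T\<close> exceed \<open>p\<close>, thinning has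
          already removed these edges and the deletion changes nothing.\<close>
        then have "thin p \<omega> u - ?T = thin p \<omega> u"
          by (force simp: thin_def)
        then show ?thesis
          using elim by (simp add: diff)
      next
        case False
        then have "\<not> (\<forall>e\<in>?T. p < restrict u ?T e)"
          by simp
        then show ?thesis
          by blast
      qed
    qed
  qed (use T Z2E_nonempty prob_space_unif in auto)
  moreover have "\<not> (AE u in PiM Z2E (\<lambda>_. unif). \<not> (\<forall>e\<in>?T. p < restrict u ?T e))"
    using noise_above_not_null[OF T finite_touching_core p] unfolding noise_def by simp
  ultimately show ?thesis
    unfolding diff noise_def by blast
qed

text \<open>Translation invariance holds only after averaging over \<omega>, whereas deletion
  tolerance and robustness concern one fixed \<omega>. Fubini passes from the former to the
  latter.\<close>

lemma thinned_not_three_infinite: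
  assumes P: "invariant_bond_perc P" and p: "0 \<le> p" "p < 1"
  shows "AE \<omega> in P. AE u in noise Z2E. \<not> three_infinite (thin p \<omega> u)"
proof -
  have prob: "prob_space P" and sets: "sets P = sets z2_cfg" and inv: "distr P P (act ((+) a)) = P" for a
    using P z2_aut_translate[of a] by (auto simp: invariant_bond_perc_def)
  interpret P: prob_space P by (rule prob)
  interpret N: prob_space "noise Z2E" by (rule prob_space_noise)
  interpret PN: pair_prob_space P "noise Z2E" ..
  have space: "space P = Pow Z2E"
    using sets_eq_imp_space_eq[OF sets] by simp
  note t = thin_pair_measurable[OF sets, of p]
  define Q where "Q = distr (P \<Otimes>\<^sub>M noise Z2E) z2_cfg (\<lambda>(\<omega>, u). thin p \<omega> u)"
  have "prob_space Q"
    unfolding Q_def by (rule PN.prob_space_distr[OF t])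
  moreover have "sets Q = sets z2_cfg"
    by (simp add: Q_def)
  moreover have "distr Q Q (act ((+) a)) = Q" for a
    unfolding Q_def by (rule thinned_translation_invariant[OF prob sets inv])
  ultimately have "AE \<omega> in Q. \<not> good L a \<omega>" if "2 \<le> L" for L a
    using that by (rule good_null)
  then have "AE x in P \<Otimes>\<^sub>M noise Z2E. \<not> good L a (case x of (\<omega>, u) \<Rightarrow> thin p \<omega> u)" if "2 \<le> L" for L a
    using that unfolding Q_def by (intro AE_distrD[OF t]) blast
  then have "AE \<omega> in P. AE u in noise Z2E. \<not> good L a (thin p \<omega> u)" if "2 \<le> L" for L a
    using PN.AE_pair[of "\<lambda>x. \<not> good L a (case x of (\<omega>, u) \<Rightarrow> thin p \<omega> u)"] that by simp
  \<comment> \<open>The condition on \<open>L\<close> moves inside the almost sure statement, so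
    that the quantifiers can range over whole countable types.\<close>
  then have "AE \<omega> in P. 2 \<le> L \<longrightarrow> (AE u in noise Z2E. \<not> good L a (thin p \<omega> u))" for L a
    by (cases "2 \<le> L") auto
  then have "AE \<omega> in P. \<forall>L a. 2 \<le> L \<longrightarrow> (AE u in noise Z2E. \<not> good L a (thin p \<omega> u))"
    by (simp only: AE_all_countable) blast
  then show ?thesis
    using AE_space
  proof eventually_elim
    case (elim \<omega>)
    then have \<omega>: "\<omega> \<subseteq> Z2E"
      by (simp add: space)
    have "AE u in noise Z2E. 2 \<le> L \<longrightarrow> \<not> good L a (thin p \<omega> u - touching (core L a))" for L a
    proof (cases "2 \<le> L")
      case True
      then have "AE u in noise Z2E. \<not> good L a (thin p \<omega> u)"
        using elim(1) by blast
      then show ?thesis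
        using not_good_after_deletion[OF \<omega> p] by simp
    qed simp
    then have "AE u in noise Z2E. \<forall>L a. 2 \<le> L \<longrightarrow> \<not> good L a (thin p \<omega> u - touching (core L a))"
      by (simp only: AE_all_countable) blast
    then show ?case
    proof eventually_elim
      case (elim u)
      have "thin p \<omega> u \<subseteq> Z2E"
        using \<omega> by (auto simp: thin_def)
      then show ?case
        using three_infinite_imp_good elim by blast
    qed
  qed
qed

section \<open>Survival of robust clusters and conclusion\<close>

lemma infinite_clust_mono: "infinite (clust F v) \<Longrightarrow> F \<subseteq> G \<Longrightarrow> infinite (clust G v)"
  by (rule infinite_super[OF clust_mono])

lemma has_inf_comp_mono: "has_inf_comp F \<Longrightarrow> F \<subseteq> G \<Longrightarrow> has_inf_comp G"
  unfolding has_inf_comp_def using infinite_clust_mono by metis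

text \<open>If components are infinite with positive probability at level 1 - \<epsilon>, the
  coupling by labels gives the same at every higher level, so one level can serve several
  clusters.\<close>

lemma robust_thinning:
  assumes \<omega>: "\<omega> \<subseteq> Z2E" and "robust \<omega> C"
  shows "\<exists>\<epsilon>>0. \<forall>p\<ge>1 - \<epsilon>. \<not> (AE u in noise Z2E. \<not> has_inf_comp (thin p (cl_edges \<omega> C) u))"
proof -
  let ?E = "cl_edges \<omega> C"
  obtain \<epsilon> where \<epsilon>: "0 < \<epsilon>" "\<epsilon> \<le> 1"
    and pos: "\<not> (AE \<eta> in bern ?E (1 - \<epsilon>). \<not> has_inf_comp {e \<in> ?E. \<eta> e})"
    using assms by (auto simp: robust_def)
  have "clust {} v = {v}" for v
    by (rule clust_untouched) simp
  then have "\<not> has_inf_comp {}"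
    unfolding has_inf_comp_def by (metis finite.emptyI finite_insert)
  then have E: "?E \<noteq> {}"
    using pos by auto
  have "\<not> (AE u in noise Z2E. \<not> has_inf_comp (thin p ?E u))" if p: "1 - \<epsilon> \<le> p" for p
  proof
    assume "AE u in noise Z2E. \<not> has_inf_comp (thin p ?E u)"
    then have "AE u in noise Z2E. \<not> has_inf_comp (thin (1 - \<epsilon>) ?E u)"
    proof eventually_elim
      case (elim u)
      have "thin (1 - \<epsilon>) ?E u \<subseteq> thin p ?E u"
        using p by (auto simp: thin_def)
      then show ?case
        using elim has_inf_comp_mono by blast
    qed
    then have "AE \<eta> in bern ?E (1 - \<epsilon>). \<not> has_inf_comp {e \<in> ?E. \<eta> e}"
      using \<epsilon> \<omega> E by (intro AE_bern_of_noise) (auto simp: cl_edges_def)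
    then show False
      using pos by contradiction
  qed
  then show ?thesis
    using \<epsilon> by blast
qed

lemma infinite_component_in_cluster:
  assumes "is_cluster \<omega> C" "has_inf_comp F" "F \<subseteq> cl_edges \<omega> C" "F \<subseteq> G" "G \<subseteq> \<omega>"
  shows "\<exists>v. C = clust \<omega> v \<and> infinite (clust G v)"
proof -
  obtain v where v: "infinite (clust F v)"
    using assms by (auto simp: has_inf_comp_def)
  \<comment> \<open>\<open>has_inf_comp\<close> allows any vertex of the plane as a witness; an
    infinite component forces it to have an edge of \<open>F\<close>, which places it in
    \<open>C\<close>.\<close>
  have "\<exists>e\<in>F. v \<in> e"
  proof (rule ccontr)
    assume "\<not> (\<exists>e\<in>F. v \<in> e)"
    then have "clust F v = {v}"
      by (intro clust_untouched) blast
    then show False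
      using v by simp
  qed
  then have "v \<in> C"
    using assms(3) unfolding cl_edges_def by blast
  then have "C = clust \<omega> v"
    using assms(1) clust_eq unfolding is_cluster_def by metis
  moreover have "infinite (clust G v)"
    using v assms(4) by (rule infinite_clust_mono)
  ultimately show ?thesis
    by blast
qed

lemma three_infinite_of_clusters:
  assumes "G \<subseteq> \<omega>" and "is_cluster \<omega> C1" "is_cluster \<omega> C2" "is_cluster \<omega> C3"
    and "C1 \<noteq> C2" "C1 \<noteq> C3" "C2 \<noteq> C3"
    and "has_inf_comp F1" "F1 \<subseteq> cl_edges \<omega> C1" "F1 \<subseteq> G"
    and "has_inf_comp F2" "F2 \<subseteq> cl_edges \<omega> C2" "F2 \<subseteq> G"
    and "has_inf_comp F3" "F3 \<subseteq> cl_edges \<omega> C3" "F3 \<subseteq> G"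
  shows "three_infinite G"
proof -
  obtain v1 v2 v3 where v: "C1 = clust \<omega> v1" "infinite (clust G v1)" "C2 = clust \<omega> v2" "infinite (clust G v2)"
      "C3 = clust \<omega> v3" "infinite (clust G v3)"
    using infinite_component_in_cluster assms by metis
  have "clust G v \<noteq> clust G w" if "clust \<omega> v \<noteq> clust \<omega> w" for v w
  proof
    assume "clust G v = clust G w"
    then have "w \<in> clust \<omega> v"
      using clust_refl[of w G] clust_mono[OF assms(1)] by blast
    then show False
      using that clust_eq by metis
  qed
  then show ?thesis
    unfolding three_infinite_def using v assms(5-7) by metis
qed

lemma cl_edges_disjoint:
  assumes "\<omega> \<subseteq> Z2E" "is_cluster \<omega> C" "is_cluster \<omega> D" "C \<noteq> D"
  shows "cl_edges \<omega> C \<inter> cl_edges \<omega> D = {}"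
proof -
  have "C \<inter> D = {}"
    using assms(2-4) clust_eq unfolding is_cluster_def by blast
  \<comment> \<open>The empty set would count as an edge inside every cluster.\<close>
  moreover have "e \<noteq> {}" if "e \<in> \<omega>" for e
    using that assms(1) by (auto simp: Z2E_def)
  ultimately show ?thesis
    unfolding cl_edges_def by blast
qed

theorem theorem1p2:
  assumes "invariant_bond_perc P"
  shows "AE \<omega> in P. \<not> (\<exists>C1 C2 C3.
            C1 \<noteq> C2 \<and> C1 \<noteq> C3 \<and> C2 \<noteq> C3 \<and>
            is_cluster \<omega> C1 \<and> is_cluster \<omega> C2 \<and> is_cluster \<omega> C3 \<and>
            robust \<omega> C1 \<and> robust \<omega> C2 \<and> robust \<omega> C3)"
proof -
  \<comment> \<open>Levels tending to 1, chosen before \<omega>: the exceptional null set has to be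
    fixed before the robustness thresholds of the clusters of \<omega> are known.\<close>
  define p where "p k = 1 - 1 / (real k + 1)" for k
  have p01: "0 \<le> p k" "p k < 1" for k
    by (auto simp: p_def)
  have "space P = Pow Z2E"
    using assms sets_eq_imp_space_eq[of P z2_cfg] by (auto simp: invariant_bond_perc_def)
  moreover have "AE \<omega> in P. \<forall>k. AE u in noise Z2E. \<not> three_infinite (thin (p k) \<omega> u)"
    unfolding AE_all_countable using thinned_not_three_infinite[OF assms p01] by blast
  then show ?thesis
    using AE_space
  proof eventually_elim
    case (elim \<omega>)
    then have \<omega>: "\<omega> \<subseteq> Z2E"
      using calculation by simp
    show ?case
    proof (rule notI, elim exE conjE)
      fix C1 C2 C3
      assume ne: "C1 \<noteq> C2" "C1 \<noteq> C3" "C2 \<noteq> C3"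
        and cl: "is_cluster \<omega> C1" "is_cluster \<omega> C2" "is_cluster \<omega> C3"
        and rob: "robust \<omega> C1" "robust \<omega> C2" "robust \<omega> C3"
      let ?E1 = "cl_edges \<omega> C1" and ?E2 = "cl_edges \<omega> C2" and ?E3 = "cl_edges \<omega> C3"
      let ?h = "\<lambda>E q u. has_inf_comp (thin q E u)"
      obtain d1 d2 d3 where d: "0 < d1" "0 < d2" "0 < d3"
        and r: "\<And>q. 1 - d1 \<le> q \<Longrightarrow> \<not> (AE u in noise Z2E. \<not> ?h ?E1 q u)"
          "\<And>q. 1 - d2 \<le> q \<Longrightarrow> \<not> (AE u in noise Z2E. \<not> ?h ?E2 q u)"
          "\<And>q. 1 - d3 \<le> q \<Longrightarrow> \<not> (AE u in noise Z2E. \<not> ?h ?E3 q u)"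
        using rob[THEN robust_thinning[OF \<omega>]] by metis
      \<comment> \<open>As 1 - p k = 1 / (k + 1), this level lies above the thresholds of all three
        clusters.\<close>
      obtain k where "1 / (real k + 1) < min d1 (min d2 d3)"
        using d reals_Archimedean[of "min d1 (min d2 d3)"] by (auto simp: inverse_eq_divide add.commute)
      then have k: "1 - d1 \<le> p k" "1 - d2 \<le> p k" "1 - d3 \<le> p k"
        by (auto simp: p_def)
      have sub: "?E1 \<subseteq> Z2E" "?E2 \<subseteq> Z2E" "?E3 \<subseteq> Z2E"
        using \<omega> by (auto simp: cl_edges_def)
      have dis: "?E1 \<inter> ?E2 = {}" "?E1 \<inter> ?E3 = {}" "?E2 \<inter> ?E3 = {}"
        using cl_edges_disjoint[OF \<omega>] cl ne by blast+
      have meas: "Measurable.pred (PiM K (\<lambda>_. unif)) (\<lambda>u. \<not> ?h E (p k) u)" if "E \<subseteq> K" "E \<subseteq> Z2E" for E K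
        using measurable_compose[OF thin_measurable[OF that, of "p k"] pred_has_inf_comp]
        unfolding noise_def by measurable
      have disj: "(AE u in noise Z2E. \<not> ?h E (p k) u) \<or> (AE u in noise Z2E. B u)"
        if "AE u in noise Z2E. \<not> ?h E (p k) u \<or> B u" "Measurable.pred (PiM J (\<lambda>_. unif)) B"
          "\<And>u. B (restrict u J) = B u" "E \<subseteq> Z2E" "J \<subseteq> Z2E" "E \<inter> J = {}" for E J B
        using AE_PiM_disj_indep[of "\<lambda>_. unif" Z2E E J "\<lambda>u. \<not> ?h E (p k) u" B] that meas[of E E]
          prob_space_unif Z2E_nonempty
        unfolding noise_def by (simp add: thin_restrict)
      \<comment> \<open>The same labels thin \<omega> and the three edge sets, so joint survival
        would put three infinite clusters into the thinning of \<omega>.\<close>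
      have ae: "AE u in noise Z2E. \<not> ?h ?E1 (p k) u \<or> \<not> ?h ?E2 (p k) u \<or> \<not> ?h ?E3 (p k) u"
        using elim(1)[rule_format, of k]
      proof eventually_elim
        case (elim u)
        have "thin (p k) \<omega> u \<subseteq> \<omega>" "thin (p k) (cl_edges \<omega> C) u \<subseteq> cl_edges \<omega> C"
          "thin (p k) (cl_edges \<omega> C) u \<subseteq> thin (p k) \<omega> u" for C
          by (auto simp: thin_def cl_edges_def)
        then show ?case
          using three_infinite_of_clusters[of "thin (p k) \<omega> u" \<omega> C1 C2 C3] cl ne elim by blast
      qed
      have m23: "Measurable.pred (PiM (?E2 \<union> ?E3) (\<lambda>_. unif)) (\<lambda>u. \<not> ?h ?E2 (p k) u \<or> \<not> ?h ?E3 (p k) u)"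
        by (intro pred_intros_logic(5) meas) (use sub in auto)
      \<comment> \<open>Independence is applied twice: the labels on \<open>?E1\<close> against
        those on \<open>?E2 \<union> ?E3\<close>, then \<open>?E2\<close> against
        \<open>?E3\<close>. Hence one of the three clusters almost surely fails to survive, against
        robustness.\<close>
      have "(AE u in noise Z2E. \<not> ?h ?E1 (p k) u) \<or> (AE u in noise Z2E. \<not> ?h ?E2 (p k) u \<or> \<not> ?h ?E3 (p k) u)"
        by (rule disj[OF ae m23]) (use sub dis in \<open>auto simp: thin_restrict\<close>)
      moreover have "(AE u in noise Z2E. \<not> ?h ?E2 (p k) u) \<or> (AE u in noise Z2E. \<not> ?h ?E3 (p k) u)"
        if "AE u in noise Z2E. \<not> ?h ?E2 (p k) u \<or> \<not> ?h ?E3 (p k) u"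
        by (rule disj[OF that meas[of ?E3 ?E3]]) (use sub dis in \<open>auto simp: thin_restrict\<close>)
      ultimately show False
        using r k by blast
    qed
  qed
qed

end
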